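(* Let $p,t\ge 1$ be integers, let $X=X_1\,\dot\cup\,\cdots\,\dot\cup\,X_p$ be a finite set partitioned into nonempty blocks with $|X_i|=n_i$, and let $R\subseteq\prod_{i=1}^p\{0,1,\ldots,n_i\}$ be nonempty. Put $b_i=\max_{(r_1,\ldots,r_p)\in R}r_i$ and assume $b_i>0$ for every $i\in[p]$. Suppose $\max_{\boldsymbol r\in R}\sum_{i} r_i\ge t$ and $n_i\ge 3ptb_i$ for each $i\in[p]$. Then every $t$-intersecting family $\mathcal F\subseteq\mathcal H_R$ satisfies \[ |\mathcal F|\le\max_{\substack{(s_1,\dots,s_p)\in\mathbb{Z}_{\ge0}^p\\ s_1+\cdots+s_p=t}}\ \sum_{\boldsymbol r\in R}\ \prod_{i=1}^p\binom{n_i-s_i}{r_i-s_i}. \] Equality holds if and only if $\mathcal F$ is a full $t$-star (in $\mathcal H_R$) whose cardinality attains the maximum on the right-hand side.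
   Context: $[m]=\{1,\ldots,m\}$, and $\binom{m}{\ell}=0$ whenever $\ell<0$ or $\ell>m$. For $\boldsymbol r=(r_1,\ldots,r_p)$ with $0\le r_i\le n_i$, $\mathcal H(\boldsymbol r)=\{F\subseteq X: |F\cap X_i|=r_i\text{ for every }i\in[p]\}$, and $\mathcal H_R=\bigcup_{\boldsymbol r\in R}\mathcal H(\boldsymbol r)$. A family $\mathcal F$ of sets is $t$-intersecting if $|F\cap F'|\ge t$ for all $F,F'\in\mathcal F$ (including $F=F'$). A full $t$-star in $\mathcal H_R$ is a family of the form $\{F\in\mathcal H_R: T\subseteq F\}$ for some $T\subseteq X$ with $|T|=t$. *)

theory Defs
  imports Main "HOL-Library.FuncSet" "HOL-Library.Disjoint_Sets"
begin

text \<open>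
  Vectors indexed by \<open>[p]\<close> are functions on \<open>{1..p}\<close> that are \<open>undefined\<close> elsewhere
  (\<open>PiE\<close>), so that each vector is represented by exactly one function; this matters
  for the sums and maxima over sets of vectors.
\<close>

text \<open>Integer arguments, so that \<open>r - s\<close> is not truncated when \<open>s > r\<close>.\<close>

definition binom :: "int \<Rightarrow> int \<Rightarrow> nat" where
  "binom m l = (if l < 0 \<or> l > m then 0 else nat m choose nat l)"

definition layer :: "nat \<Rightarrow> (nat \<Rightarrow> 'a set) \<Rightarrow> (nat \<Rightarrow> nat) \<Rightarrow> 'a set set" where
  "layer p X r = {F. F \<subseteq> (\<Union>i\<in>{1..p}. X i) \<and> (\<forall>i\<in>{1..p}. card (F \<inter> X i) = r i)}"

definition layers :: "nat \<Rightarrow> (nat \<Rightarrow> 'a set) \<Rightarrow> (nat \<Rightarrow> nat) set \<Rightarrow> 'a set set" where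
  "layers p X R = (\<Union>r\<in>R. layer p X r)"

definition t_intersecting :: "nat \<Rightarrow> 'a set set \<Rightarrow> bool" where
  "t_intersecting t \<F> \<longleftrightarrow> (\<forall>F\<in>\<F>. \<forall>F'\<in>\<F>. t \<le> card (F \<inter> F'))"

definition full_star ::
    "nat \<Rightarrow> nat \<Rightarrow> (nat \<Rightarrow> 'a set) \<Rightarrow> (nat \<Rightarrow> nat) set \<Rightarrow> 'a set set \<Rightarrow> bool" where
  "full_star t p X R \<F> \<longleftrightarrow>
     (\<exists>T. T \<subseteq> (\<Union>i\<in>{1..p}. X i) \<and> card T = t \<and> \<F> = {F \<in> layers p X R. T \<subseteq> F})"

definition weak_compositions :: "nat \<Rightarrow> nat \<Rightarrow> (nat \<Rightarrow> nat) set" where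
  "weak_compositions p t = {s \<in> {1..p} \<rightarrow>\<^sub>E UNIV. (\<Sum>i\<in>{1..p}. s i) = t}"

text \<open>The following two facts make \<open>Max\<close> over \<open>weak_compositions p t\<close> meaningful.\<close>

lemma finite_weak_compositions: "finite (weak_compositions p t)"
proof (rule finite_subset)
  show "weak_compositions p t \<subseteq> {1..p} \<rightarrow>\<^sub>E {0..t}"
  proof
    fix s assume s: "s \<in> weak_compositions p t"
    have "s i \<le> t" if "i \<in> {1..p}" for i
      using s member_le_sum[OF that, of s] by (simp add: weak_compositions_def)
    with s show "s \<in> {1..p} \<rightarrow>\<^sub>E {0..t}"
      by (auto simp: weak_compositions_def PiE_iff)
  qed
qed (intro finite_PiE; simp)

lemma weak_compositions_nonempty:
  assumes "p \<ge> 1"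
  shows "weak_compositions p t \<noteq> {}"
proof -
  have "(\<lambda>i\<in>{1..p}. if i = 1 then t else 0) \<in> weak_compositions p t"
    using assms by (simp add: weak_compositions_def)
  then show ?thesis by blast
qed

definition star_bound :: "nat \<Rightarrow> nat \<Rightarrow> (nat \<Rightarrow> nat) \<Rightarrow> (nat \<Rightarrow> nat) set \<Rightarrow> nat" where
  "star_bound t p n R =
     Max ((\<lambda>s. \<Sum>r\<in>R. \<Prod>i\<in>{1..p}. binom (int (n i) - int (s i)) (int (r i) - int (s i)))
          ` weak_compositions p t)"

end

theory Submission
  imports Defs
begin

text \<open>
  Order every block \<open>X\<^sub>i\<close> and shift a family of maximum size until it is stable; a shift that ends in a
  full star starts from a full star, because two members of a star have a third one that
  meets both only in the kernel (\<open>3 b\<^sub>i \<le> n\<^sub>i\<close>).  So let the family be stable.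

  Write \<open>Y\<close> for a set on which members already meet in at least \<open>t\<close> points, and call two traces on \<open>Y\<close>
  conflicting at \<open>y\<close> if they contain \<open>y\<close> and share exactly \<open>t\<close> points.  If a collection of traces has no
  conflict at \<open>y\<close> inside it, dropping \<open>y\<close> from all of them and deleting the other conflicting traces
  leaves a \<open>t\<close>-intersecting family, so maximality bounds the weight of the collection (the
  pushing argument of Ahlswede and Khachatrian).  Stability makes the traces that miss a fixed point
  below \<open>y\<close> such a collection.  Averaging over these points shows that there is no conflict at
  the last point of \<open>Y\<close> in a block once that block holds more than \<open>t\<close> points of \<open>Y\<close>; thus \<open>Y\<close> shrinks to
  the first \<open>t\<close> points of each block.  The same bound shows that few members have a trace whose
  largest initial part is not itself a trace.  If no trace has size \<open>t\<close>, the remaining members are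
  counted by extending the \<open>t\<close>-element initial parts of a smallest initial trace one point at a time:
  each step has at most \<open>p\<close> choices and costs a factor \<open>3pt\<close>.  Both counts together
  stay below the size of the family.
\<close>

section \<open>Exchange ratios\<close>

lemma card_Int_Un:
  assumes "finite A"
  shows "card ((E \<union> E') \<inter> A) + card (E \<inter> E' \<inter> A) = card (E \<inter> A) + card (E' \<inter> A)"
proof -
  have "(E \<union> E') \<inter> A = (E \<inter> A) \<union> (E' \<inter> A)" "E \<inter> E' \<inter> A = (E \<inter> A) \<inter> (E' \<inter> A)" by blast+
  then show ?thesis using card_Un_Int[of "E \<inter> A" "E' \<inter> A"] assms by simp
qed

locale partite_family =
  fixes p t :: nat and X :: "nat \<Rightarrow> 'a set" and b :: "nat \<Rightarrow> nat" and H :: "'a set set"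
  assumes p_pos: "1 \<le> p" and t_pos: "1 \<le> t"
    and finite_part: "i \<in> {1..p} \<Longrightarrow> finite (X i)"
    and disjoint_parts: "disjoint_family_on X {1..p}"
    and H_subset: "F \<in> H \<Longrightarrow> F \<subseteq> (\<Union>i\<in>{1..p}. X i)"
    and H_card: "F \<in> H \<Longrightarrow> i \<in> {1..p} \<Longrightarrow> card (F \<inter> X i) \<le> b i"
    and H_swap: "F \<in> H \<Longrightarrow> i \<in> {1..p} \<Longrightarrow> y \<in> F \<inter> X i \<Longrightarrow> z \<in> X i - F \<Longrightarrow> insert z (F - {y}) \<in> H"
    and H_large: "\<exists>F\<in>H. t \<le> card F"
    and b_pos: "i \<in> {1..p} \<Longrightarrow> 0 < b i"
    and part_large: "i \<in> {1..p} \<Longrightarrow> 3 * p * t * b i \<le> card (X i)"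
begin

abbreviation U :: "'a set" where "U \<equiv> (\<Union>i\<in>{1..p}. X i)"

definition traced :: "'a set \<Rightarrow> 'a set \<Rightarrow> 'a set set" where
  "traced Y E = {F \<in> H. F \<inter> Y = E}"

definition star :: "'a set \<Rightarrow> 'a set set" where
  "star S = {F \<in> H. S \<subseteq> F}"

abbreviation m :: "'a set \<Rightarrow> 'a set \<Rightarrow> nat" where "m Y E \<equiv> card (traced Y E)"

lemma finite_U: "finite U"
  using finite_part by blast

lemma finite_H: "finite H"
  by (rule finite_subset[of _ "Pow U"]) (use H_subset finite_U in auto)

lemma finite_member: "F \<in> H \<Longrightarrow> finite F"
  using H_subset finite_U finite_subset by blast

lemma finite_traced [simp]: "finite (traced Y E)"
  unfolding traced_def using finite_H by simp

lemma finite_star [simp]: "finite (star S)"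
  unfolding star_def using finite_H by simp

lemma part_unique: "x \<in> X i \<Longrightarrow> x \<in> X j \<Longrightarrow> i \<in> {1..p} \<Longrightarrow> j \<in> {1..p} \<Longrightarrow> i = j"
  using disjoint_parts unfolding disjoint_family_on_def by blast

lemma part_ge: 
  assumes "i \<in> {1..p}"
  shows "3 * t * b i \<le> card (X i)"
proof -
  have "3 * t * b i \<le> p * (3 * t * b i)" using p_pos by simp
  also have "\<dots> \<le> card (X i)" using part_large[OF assms] by (simp add: mult_ac)
  finally show ?thesis .
qed

lemma part_gt:
  assumes "i \<in> {1..p}"
  shows "b i + t < card (X i)" "3 * b i \<le> card (X i)"
proof -
  obtain t' where t': "t = Suc t'" using t_pos by (cases t) auto
  obtain b' where b': "b i = Suc b'" using b_pos[OF assms] by (cases "b i") auto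
  show "b i + t < card (X i)" "3 * b i \<le> card (X i)" using part_ge[OF assms] by (simp_all add: t' b' algebra_simps)
qed

lemma ratio_traced:
  assumes i: "i \<in> {1..p}" and E: "E \<subseteq> Y" "y \<in> E" "y \<in> X i"
  shows "(card (X i) + 1 - card (Y \<inter> X i)) * m Y E
    \<le> (b i + 1 - card (E \<inter> X i)) * (m Y E + m Y (E - {y}))"
proof -
  let ?W = "\<lambda>F. X i - (F \<union> Y)" and ?V = "\<lambda>F. F \<inter> X i - Y"
  let ?e = "card (E \<inter> X i)" and ?l = "card (Y \<inter> X i)"
  have fX: "finite (X i)" using finite_part i by blast
  have "card (SIGMA F:traced Y E. ?W F) \<le> card (SIGMA F:traced Y (E - {y}). ?V F)"
  proof (rule card_inj_on_le[where f = "\<lambda>(F, w). (insert w (F - {y}), w)"])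
    show "inj_on (\<lambda>(F, w). (insert w (F - {y}), w)) (SIGMA F:traced Y E. ?W F)"
    proof (rule inj_onI)
      fix a a'
      assume a: "a \<in> (SIGMA F:traced Y E. ?W F)" "a' \<in> (SIGMA F:traced Y E. ?W F)"
        "(\<lambda>(F, w). (insert w (F - {y}), w)) a = (\<lambda>(F, w). (insert w (F - {y}), w)) a'"
      obtain F w F' w' where eq: "a = (F, w)" "a' = (F', w')" by (cases a, cases a')
      have "w' = w" "insert w (F - {y}) = insert w (F' - {y})" "w \<notin> F" "w \<notin> F'" "y \<in> F" "y \<in> F'"
        using a E by (auto simp: eq traced_def)
      moreover from this have "F - {y} = F' - {y}" by (metis Diff_iff insert_ident)
      ultimately show "a = a'" unfolding eq by blast
    qed
    show "(\<lambda>(F, w). (insert w (F - {y}), w)) ` (SIGMA F:traced Y E. ?W F)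
      \<subseteq> (SIGMA F:traced Y (E - {y}). ?V F)"
      using E H_swap[OF _ i] by (fastforce simp: traced_def)
    show "finite (SIGMA F:traced Y (E - {y}). ?V F)" using fX by auto
  qed
  also have "card (SIGMA F:traced Y (E - {y}). ?V F) = (\<Sum>F\<in>traced Y (E - {y}). card (?V F))"
    using fX by (simp add: card_SigmaI)
  also have "\<dots> \<le> (\<Sum>F\<in>traced Y (E - {y}). b i + 1 - ?e)"
  proof (rule sum_mono)
    fix F assume F: "F \<in> traced Y (E - {y})"
    have "?V F = F \<inter> X i - (E - {y}) \<inter> X i" using F by (auto simp: traced_def)
    moreover have "(E - {y}) \<inter> X i \<subseteq> F \<inter> X i" using F by (auto simp: traced_def)
    ultimately have "card (?V F) = card (F \<inter> X i) - card ((E - {y}) \<inter> X i)"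
      using fX by (simp add: card_Diff_subset)
    moreover have "card ((E - {y}) \<inter> X i) = ?e - 1"
      using E fX by (simp add: Diff_Int_distrib2)
    moreover have "?e \<ge> 1" using E fX by (metis IntI One_nat_def Suc_leI card_gt_0_iff empty_iff finite_Int)
    ultimately show "card (?V F) \<le> b i + 1 - ?e" using H_card[of F i] F i by (auto simp: traced_def)
  qed
  finally have le1: "card (SIGMA F:traced Y E. ?W F) \<le> (b i + 1 - ?e) * m Y (E - {y})"
    by (simp add: mult.commute)
  have "(\<Sum>F\<in>traced Y E. card (X i) + ?e - ?l - b i) \<le> (\<Sum>F\<in>traced Y E. card (?W F))"
  proof (rule sum_mono)
    fix F assume F: "F \<in> traced Y E"
    have "card ((F \<union> Y) \<inter> X i) + card (F \<inter> Y \<inter> X i) = card (F \<inter> X i) + ?l"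
      using card_Int_Un[OF fX] by simp
    moreover have "F \<inter> Y = E" using F by (simp add: traced_def)
    moreover have "card (?W F) = card (X i) - card ((F \<union> Y) \<inter> X i)"
      using fX by (metis Int_commute card_Diff_subset_Int finite_Int)
    ultimately show "card (X i) + ?e - ?l - b i \<le> card (?W F)"
      using H_card[of F i] F i by (auto simp: traced_def)
  qed
  also have "\<dots> = card (SIGMA F:traced Y E. ?W F)" using fX by (simp add: card_SigmaI)
  finally have le2: "(card (X i) + ?e - ?l - b i) * m Y E \<le> (b i + 1 - ?e) * m Y (E - {y})"
    using le1 by (simp add: mult.commute)
  show ?thesis
  proof (cases "traced Y E = {}")
    case False
    then obtain F where F: "F \<in> H" "F \<inter> Y = E" by (auto simp: traced_def)
    have "?e \<le> card (F \<inter> X i)" by (rule card_mono) (use F fX in auto)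
    then have "?e \<le> b i" using H_card[OF F(1) i] by simp
    then have "card (X i) + 1 - ?l \<le> (card (X i) + ?e - ?l - b i) + (b i + 1 - ?e)" by simp
    then have "(card (X i) + 1 - ?l) * m Y E \<le> ((card (X i) + ?e - ?l - b i) + (b i + 1 - ?e)) * m Y E"
      by (rule mult_right_mono) simp
    also have "\<dots> \<le> (b i + 1 - ?e) * m Y (E - {y}) + (b i + 1 - ?e) * m Y E"
      using le2 by (simp add: add_mult_distrib)
    finally show ?thesis by (simp add: algebra_simps)
  qed simp
qed

lemma ratio_star:
  assumes i: "i \<in> {1..p}" and z: "z \<in> X i" "z \<notin> S" and S: "S \<subseteq> U"
  shows "3 * p * t * card (star (insert z S)) \<le> card (star S)"
proof -
  let ?Y = "insert z S"
  let ?e = "card (?Y \<inter> X i)"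
  have fX: "finite (X i)" using finite_part i by blast
  have e: "?e \<ge> 1" using z fX by (metis IntI One_nat_def Suc_leI card_gt_0_iff empty_iff finite_Int insertI1)
  have t1: "traced ?Y ?Y = star ?Y" by (auto simp: traced_def star_def)
  have t2: "traced ?Y (?Y - {z}) = star S - star ?Y" using z by (auto simp: traced_def star_def)
  have sub: "star ?Y \<subseteq> star S" by (auto simp: star_def)
  have "m ?Y ?Y + m ?Y (?Y - {z}) = card (star S)"
    unfolding t1 t2 using sub by (simp add: card_Diff_subset card_mono)
  then have le: "(card (X i) + 1 - ?e) * card (star ?Y) \<le> (b i + 1 - ?e) * card (star S)"
    using ratio_traced[OF i, of ?Y ?Y z] z t1 by simp
  show ?thesis
  proof (cases "star ?Y = {}")
    case False
    then obtain F where F: "F \<in> H" "?Y \<subseteq> F" by (auto simp: star_def)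
    have "?e \<le> card (F \<inter> X i)" by (rule card_mono) (use F fX in auto)
    then have eb: "?e \<le> b i" using H_card[OF F(1) i] by simp
    define k where "k = b i + 1 - ?e"
    define d where "d = ?e - 1"
    have kd: "b i = k + d" "k > 0" "?e = d + 1" using eb e by (auto simp: k_def d_def)
    have N: "3 * p * t * (k + d) \<le> card (X i)" using part_large[OF i] kd by simp
    have "1 * d \<le> (3 * p * t) * d" by (rule mult_right_mono) (use p_pos t_pos in auto)
    then have "3 * p * t * k + d \<le> card (X i)" using N by (simp only: distrib_left mult_1)
    then have "3 * p * t * k \<le> card (X i) + 1 - ?e" using kd by linarith
    then have "3 * p * t * k * card (star ?Y) \<le> (card (X i) + 1 - ?e) * card (star ?Y)"
      by (rule mult_right_mono) simp
    also have "\<dots> \<le> k * card (star S)" using le kd by simp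
    finally have "k * (3 * p * t * card (star ?Y)) \<le> k * card (star S)" by (simp add: mult_ac)
    then show ?thesis using kd by simp
  qed simp
qed

end

section \<open>Maximum families and conflicting traces\<close>

context partite_family
begin

definition max_family :: "'a set set \<Rightarrow> bool" where
  "max_family \<F> \<longleftrightarrow> \<F> \<subseteq> H \<and> t_intersecting t \<F> \<and>
     (\<forall>\<G>. \<G> \<subseteq> H \<longrightarrow> t_intersecting t \<G> \<longrightarrow> card \<G> \<le> card \<F>)"

lemma t_intersecting_star:
  assumes "card T = t" "T \<subseteq> U"
  shows "t_intersecting t (star T)"
  unfolding t_intersecting_def
proof (intro ballI)
  fix F F' assume F: "F \<in> star T" "F' \<in> star T"
  then have "T \<subseteq> F \<inter> F'" "finite F" using finite_member by (auto simp: star_def)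
  then show "t \<le> card (F \<inter> F')" using assms card_mono[of "F \<inter> F'" T] by auto
qed

lemma max_family_extend:
  assumes max: "max_family \<F>" and F: "F \<in> H" and meet: "\<And>F'. F' \<in> \<F> \<Longrightarrow> t \<le> card (F \<inter> F')"
    and self: "t \<le> card F"
  shows "F \<in> \<F>"
proof (rule ccontr)
  assume "F \<notin> \<F>"
  moreover have "finite \<F>" using max finite_H finite_subset by (auto simp: max_family_def)
  ultimately have "card (insert F \<F>) = Suc (card \<F>)" by simp
  moreover have "t_intersecting t (insert F \<F>)"
    using max meet self by (auto simp: max_family_def t_intersecting_def Int_commute)
  ultimately show False using max F unfolding max_family_def by (metis Suc_n_not_le_n insert_subset)
qed

lemma max_family_nonempty:
  assumes "max_family \<F>"
  shows "0 < card \<F>"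
proof -
  obtain F where "F \<in> H" "t \<le> card F" using H_large by blast
  then have "card {F} \<le> card \<F>"
    using assms unfolding max_family_def by (auto simp: t_intersecting_def)
  then show ?thesis by simp
qed

end

locale stable_family = partite_family +
  fixes pos :: "'a \<Rightarrow> nat" and \<F> :: "'a set set"
  assumes pos_bij: "i \<in> {1..p} \<Longrightarrow> bij_betw pos (X i) {..<card (X i)}"
    and max: "max_family \<F>"
    and stable: "i \<in> {1..p} \<Longrightarrow> x \<in> X i \<Longrightarrow> y \<in> X i \<Longrightarrow> pos x < pos y \<Longrightarrow> A \<in> \<F> \<Longrightarrow> y \<in> A \<Longrightarrow> x \<notin> A
      \<Longrightarrow> insert x (A - {y}) \<in> \<F>"
begin

definition det :: "'a set \<Rightarrow> bool" where
  "det Y \<longleftrightarrow> Y \<subseteq> U \<and> (\<forall>F\<in>\<F>. \<forall>F'\<in>\<F>. t \<le> card (F \<inter> F' \<inter> Y))"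

definition tra :: "'a set \<Rightarrow> 'a set set" where
  "tra Y = (\<lambda>F. F \<inter> Y) ` \<F>"

definition conflicting :: "'a set \<Rightarrow> 'a \<Rightarrow> 'a set set" where
  "conflicting Y y = {E \<in> tra Y. y \<in> E \<and> (\<exists>E'\<in>tra Y. y \<in> E' \<and> card (E \<inter> E') = t)}"

lemma family_H: "F \<in> \<F> \<Longrightarrow> F \<in> H"
  using max by (auto simp: max_family_def)

lemma finite_family: "finite \<F>"
  using max finite_H finite_subset by (auto simp: max_family_def)

lemma finite_tra: "finite (tra Y)"
  using finite_family by (simp add: tra_def)

lemma tra_subset: "E \<in> tra Y \<Longrightarrow> E \<subseteq> Y"
  by (auto simp: tra_def)

lemma finite_tra_member: "E \<in> tra Y \<Longrightarrow> finite E"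
  using family_H finite_member by (auto simp: tra_def)

lemma tra_meet: "det Y \<Longrightarrow> E \<in> tra Y \<Longrightarrow> E' \<in> tra Y \<Longrightarrow> t \<le> card (E \<inter> E')"
  by (auto simp: det_def tra_def Int_ac)

lemma finite_det: "det Y \<Longrightarrow> finite Y"
  unfolding det_def using finite_subset[OF _ finite_U] by blast

lemma sum_traced_le:
  assumes Y: "finite Y" and S: "\<And>E. E \<in> \<S> \<Longrightarrow> E \<subseteq> Y"
    and meet: "\<And>E E'. E \<in> \<S> \<Longrightarrow> E' \<in> \<S> \<Longrightarrow> t \<le> card (E \<inter> E')"
  shows "(\<Sum>E\<in>\<S>. m Y E) \<le> card \<F>"
proof -
  have fS: "finite \<S>" by (rule finite_subset[of _ "Pow Y"]) (use S Y in auto)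
  have "t_intersecting t (\<Union>E\<in>\<S>. traced Y E)"
    unfolding t_intersecting_def
  proof (intro ballI)
    fix F F' assume "F \<in> (\<Union>E\<in>\<S>. traced Y E)" "F' \<in> (\<Union>E\<in>\<S>. traced Y E)"
    then have "F \<in> H" "F \<inter> Y \<in> \<S>" "F' \<inter> Y \<in> \<S>" by (auto simp: traced_def)
    then have "t \<le> card (F \<inter> Y \<inter> (F' \<inter> Y))" using meet by blast
    also have "\<dots> \<le> card (F \<inter> F')" by (rule card_mono) (use \<open>F \<in> H\<close> finite_member in auto)
    finally show "t \<le> card (F \<inter> F')" .
  qed
  moreover have "(\<Union>E\<in>\<S>. traced Y E) \<subseteq> H" by (auto simp: traced_def)
  ultimately have "card (\<Union>E\<in>\<S>. traced Y E) \<le> card \<F>" using max by (auto simp: max_family_def)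
  moreover have "card (\<Union>E\<in>\<S>. traced Y E) = (\<Sum>E\<in>\<S>. m Y E)"
  proof (rule card_UN_disjoint)
    show "\<forall>E\<in>\<S>. \<forall>E'\<in>\<S>. E \<noteq> E' \<longrightarrow> traced Y E \<inter> traced Y E' = {}" by (auto simp: traced_def)
  qed (use fS in auto)
  ultimately show ?thesis by simp
qed

lemma card_le_sum_tra: "card \<F> \<le> (\<Sum>E\<in>tra Y. m Y E)"
proof -
  have "card \<F> \<le> card (\<Union>E\<in>tra Y. traced Y E)"
  proof (rule card_mono)
    show "finite (\<Union>E\<in>tra Y. traced Y E)" by (simp add: finite_tra)
    show "\<F> \<subseteq> (\<Union>E\<in>tra Y. traced Y E)" using family_H by (auto simp: tra_def traced_def)
  qed
  also have "\<dots> \<le> (\<Sum>E\<in>tra Y. m Y E)"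
    by (rule card_UN_le) (simp add: finite_tra)
  finally show ?thesis .
qed

lemma sum_tra: "det Y \<Longrightarrow> (\<Sum>E\<in>tra Y. m Y E) = card \<F>"
  using card_le_sum_tra[of Y] sum_traced_le[of Y "tra Y"] tra_meet tra_subset finite_det
  by (simp add: le_antisym)

lemma conflicting_tra: "E \<in> conflicting Y y \<Longrightarrow> E \<in> tra Y \<and> y \<in> E"
  by (simp add: conflicting_def)

text \<open>If no two members of \<open>S\<close> conflict, then \<open>y\<close> may be dropped from all of them at the cost of
  deleting the other conflicting traces; by maximality this gains nothing.\<close>

lemma independent_le:
  assumes Y: "det Y" and S: "S \<subseteq> conflicting Y y"
    and indep: "\<And>E E'. E \<in> S \<Longrightarrow> E' \<in> S \<Longrightarrow> t < card (E \<inter> E')"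
  shows "(\<Sum>E\<in>S. m Y E + m Y (E - {y})) \<le> (\<Sum>E\<in>conflicting Y y. m Y E)"
proof -
  let ?C = "conflicting Y y" and ?d = "\<lambda>E. E - {y}"
  let ?K = "tra Y - (?C - S)"
  have S_tra: "E \<in> tra Y" "y \<in> E" "finite E" if "E \<in> S" for E
    using that S finite_tra_member by (auto simp: conflicting_def)
  have C_tra: "?C \<subseteq> tra Y" by (auto simp: conflicting_def)
  have fin: "finite ?C" "finite S" "finite ?K"
    using finite_subset[OF C_tra] finite_subset[OF S] finite_tra by auto
  have drop: "?d E \<notin> tra Y" if ES: "E \<in> S" for E
  proof
    assume d: "?d E \<in> tra Y"
    obtain E' where E': "E' \<in> tra Y" "y \<in> E'" "card (E \<inter> E') = t"
      using ES S unfolding conflicting_def by blast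
    have "card (?d E \<inter> E') < card (E \<inter> E')"
      by (rule psubset_card_mono) (use S_tra[OF ES] E' in auto)
    then show False using tra_meet[OF Y d E'(1)] E'(3) by simp
  qed
  have drop_one: "card (A - {y}) \<ge> t" if "card A > t" for A :: "'a set"
    using diff_card_le_card_Diff[of "{y}" A] that by simp
  have meetSK: "t \<le> card (?d E \<inter> E')" if "E \<in> S" "E' \<in> ?K" for E E'
  proof (cases "y \<in> E'")
    case True
    have "t < card (E \<inter> E')"
    proof (cases "E' \<in> S")
      case True then show ?thesis using indep that by blast
    next
      case False
      then have "E' \<notin> ?C" using that by blast
      then have "card (E' \<inter> E) \<noteq> t" using that True S_tra[OF that(1)] by (auto simp: conflicting_def)
      then show ?thesis using tra_meet[OF Y, of E E'] that S_tra by (simp add: Int_commute)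
    qed
    then have "t \<le> card (E \<inter> E' - {y})" by (rule drop_one)
    moreover have "E \<inter> E' - {y} = ?d E \<inter> E'" by blast
    ultimately show ?thesis by simp
  next
    case False
    then have "?d E \<inter> E' = E \<inter> E'" by blast
    then show ?thesis using tra_meet[OF Y, of E E'] that S_tra by simp
  qed
  have meetSS: "t \<le> card (?d E \<inter> ?d E')" if "E \<in> S" "E' \<in> S" for E E'
  proof -
    have "?d E \<inter> ?d E' = E \<inter> E' - {y}" by blast
    then show ?thesis using drop_one[OF indep[OF that]] by simp
  qed
  have "(\<Sum>E\<in>?K \<union> ?d ` S. m Y E) \<le> card \<F>"
  proof (rule sum_traced_le)
    show "finite Y" using finite_det Y .
    show "E \<subseteq> Y" if "E \<in> ?K \<union> ?d ` S" for E using that tra_subset S_tra by blast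
    fix E E' assume "E \<in> ?K \<union> ?d ` S" "E' \<in> ?K \<union> ?d ` S"
    then show "t \<le> card (E \<inter> E')"
      using tra_meet[OF Y, of E E'] meetSK meetSS by (auto simp: Int_commute)
  qed
  also have "(\<Sum>E\<in>?K \<union> ?d ` S. m Y E) = (\<Sum>E\<in>?K. m Y E) + (\<Sum>E\<in>?d ` S. m Y E)"
    by (rule sum.union_disjoint) (use fin drop in auto)
  also have "(\<Sum>E\<in>?d ` S. m Y E) = (\<Sum>E\<in>S. m Y (?d E))"
    by (rule sum.reindex_cong[OF _ refl refl]) (use S_tra in \<open>auto intro!: inj_onI\<close>)
  also have "card \<F> = (\<Sum>E\<in>?K. m Y E) + (\<Sum>E\<in>?C - S. m Y E)"
    unfolding sum_tra[OF Y, symmetric] using C_tra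
    by (subst sum.subset_diff[of "?C - S"]) (auto simp: finite_tra)
  finally have "(\<Sum>E\<in>S. m Y (?d E)) \<le> (\<Sum>E\<in>?C - S. m Y E)" by simp
  moreover have "(\<Sum>E\<in>?C. m Y E) = (\<Sum>E\<in>?C - S. m Y E) + (\<Sum>E\<in>S. m Y E)"
    by (rule sum.subset_diff) (use S fin in auto)
  ultimately show ?thesis by (simp add: sum.distrib)
qed

lemma tra_shift:
  assumes i: "i \<in> {1..p}" "x \<in> X i" "y \<in> X i" "pos x < pos y" and Y: "x \<in> Y" and E: "E \<in> tra Y" "y \<in> E" "x \<notin> E"
  shows "insert x (E - {y}) \<in> tra Y"
proof -
  obtain F where F: "F \<in> \<F>" "E = F \<inter> Y" using E by (auto simp: tra_def)
  then have "insert x (F - {y}) \<in> \<F>" using stable[OF i] E Y by auto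
  moreover have "insert x (E - {y}) = insert x (F - {y}) \<inter> Y" using F Y by auto
  ultimately show ?thesis by (auto simp: tra_def)
qed

lemma missing_independent:
  assumes Y: "det Y" and i: "i \<in> {1..p}" "x \<in> X i" "y \<in> X i" "pos x < pos y" "x \<in> Y"
    and E: "E \<in> tra Y" "y \<in> E" "x \<notin> E" and E': "E' \<in> tra Y" "y \<in> E'" "x \<notin> E'"
  shows "t < card (E \<inter> E')"
proof -
  have "t \<le> card (insert x (E - {y}) \<inter> E')"
    using tra_meet[OF Y tra_shift[OF i E] E'(1)] .
  also have "\<dots> < card (E \<inter> E')"
    by (rule psubset_card_mono) (use E E' finite_tra_member in auto)
  finally show ?thesis .
qed

end

section \<open>Restriction to the first t points of each block\<close>

lemma removal_arith:
  fixes t l q e b n :: nat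
  assumes "1 \<le> t" "t < l" and q: "q = (l + 1 - t) div 2" and e: "1 \<le> e" "e \<le> l" "l + 1 \<le> e + b" "e \<le> b"
    and n: "3 * t * b \<le> n"
  shows "(l - 1 + q) * (b + 1 - e) < (l - e + (if l + t < 2 * e then q else 0)) * (n + 1 - l)"
proof -
  define k N c where "k = b + 1 - e" and "N = n + 1 - l"
    and "c = l - e + (if l + t < 2 * e then q else 0)"
  have k: "1 \<le> k" "b = e + k - 1" using e by (auto simp: k_def)
  have q1: "1 \<le> q" "q \<le> c" "l \<le> t + 2 * q" using assms(1,2) e(2) by (auto simp: q c_def)
  have step: "(l - 1 + q) * k < c * N" if "l - 1 + q \<le> u * q" "u * k < N" for u
  proof -
    have "(l - 1 + q) * k \<le> u * q * k" using that(1) by (rule mult_right_mono) simp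
    also have "\<dots> = q * (u * k)" by (simp add: mult_ac)
    also have "\<dots> < q * N" using that(2) q1 by simp
    also have "\<dots> \<le> c * N" using q1 by simp
    finally show ?thesis .
  qed
  have "(l - 1 + q) * k < c * N"
  proof (cases "t = 1")
    case False
    then obtain s where s: "t = s + 2" using assms(1) that[of "t - 2"] by simp
    show ?thesis
    proof (rule step[of "2 * t"])
      have "2 * t * q = 2 * (q * s) + 4 * q" by (simp add: s algebra_simps)
      moreover have "s \<le> q * s" using q1 by simp
      ultimately show "l - 1 + q \<le> 2 * t * q" using q1 s by linarith
      have "2 * k + l \<le> 3 * b" using e by (simp add: k_def)
      then have "t * (2 * k + l) \<le> t * (3 * b)" by (rule mult_left_mono) simp
      moreover have "l \<le> t * l" using assms(1) by simp
      moreover have "t * (2 * k + l) = 2 * t * k + t * l" "t * (3 * b) = 3 * t * b" by (simp_all add: algebra_simps)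
      ultimately have "2 * t * k + l \<le> n" using n by linarith
      then show "2 * t * k < N" by (simp add: N_def)
    qed
  next
    case t: True
    show ?thesis
    proof (cases "l + t < 2 * e")
      case True
      show ?thesis
      proof (rule step[of 3])
        show "l - 1 + q \<le> 3 * q" using q1 t by simp
        show "3 * k < N" using n e True by (simp add: t N_def k_def)
      qed
    next
      case False
      define a d h where "a = e - 1" and "d = l + 1 - 2 * e" and "h = (l + 2 - 2 * e) div 2"
      obtain r where r: "e + b = l + 1 + r" using e(3) le_Suc_ex by blast
      have ea: "e = a + 1" "l = 2 * a + 1 + d" using False e t by (auto simp: a_def d_def)
      have b: "b = a + d + r + 1" using r ea by simp
      have kq: "k = d + r + 1" "q = a + h" "c = a + d" "2 * h \<le> d + 1" "d = 0 \<Longrightarrow> h = 0"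
        using False ea b by (auto simp: k_def q t c_def h_def)
      have N: "a + 2 * d + 3 * r + 3 \<le> N" using n by (simp add: t b ea N_def)
      have "(l - 1 + q) * k < (a + d) * (a + 2 * d + 3 * r + 3)"
      proof (cases d)
        case 0
        then have "1 \<le> a" using assms(2) t ea by simp
        then have "0 < a * a" by simp
        then show ?thesis using 0 kq ea by (simp add: algebra_simps)
      next
        case (Suc d')
        have "2 * (l - 1 + q) * k \<le> (6 * a + 3 * d + 1) * k"
          by (rule mult_right_mono) (use ea kq in auto)
        also have "\<dots> < 2 * ((a + d) * (a + 2 * d + 3 * r + 3))"
          by (simp add: kq(1) Suc algebra_simps)
        finally have "2 * ((l - 1 + q) * k) < 2 * ((a + d) * (a + 2 * d + 3 * r + 3))" by (simp only: mult.assoc)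
        then show ?thesis by (simp only: mult_less_cancel1)
      qed
      also have "\<dots> \<le> c * N" using N kq by simp
      finally show ?thesis .
    qed
  qed
  then show ?thesis by (simp only: k_def N_def c_def)
qed

context stable_family
begin

lemma card_initial:
  assumes i: "i \<in> {1..p}" and l: "l \<le> card (X i)"
  shows "card {x \<in> X i. pos x < l} = l"
proof -
  have "pos ` {x \<in> X i. pos x < l} = pos ` X i \<inter> {..<l}" by blast
  also have "\<dots> = {..<l}" using bij_betw_imp_surj_on[OF pos_bij[OF i]] l by auto
  finally have "pos ` {x \<in> X i. pos x < l} = {..<l}" .
  moreover have "inj_on pos {x \<in> X i. pos x < l}"
    using bij_betw_imp_inj_on[OF pos_bij[OF i]] by (rule inj_on_subset) auto
  ultimately show ?thesis by (metis card_image card_lessThan)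
qed

lemma pos_eqD: "i \<in> {1..p} \<Longrightarrow> x \<in> X i \<Longrightarrow> y \<in> X i \<Longrightarrow> pos x = pos y \<Longrightarrow> x = y"
  using bij_betw_imp_inj_on[OF pos_bij] by (auto dest: inj_onD)

lemma pos_less: "i \<in> {1..p} \<Longrightarrow> x \<in> X i \<Longrightarrow> pos x < card (X i)"
  using bij_betw_imp_surj_on[OF pos_bij] by blast

lemma det_remove_last:
  assumes i: "i \<in> {1..p}" and Y: "det Y" and Yi: "Y \<inter> X i = {x \<in> X i. pos x < l}"
    and l: "t < l" and y: "y \<in> X i" "Suc (pos y) = l"
  shows "det (Y - {y})"
proof (rule ccontr)
  assume nd: "\<not> det (Y - {y})"
  define C where "C = conflicting Y y"
  define M where "M = (\<Sum>E\<in>C. m Y E)"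
  define w where "w E = m Y E + m Y (E - {y})" for E
  define e where "e E = card (E \<inter> X i)" for E
  define q where "q = (l + 1 - t) div 2"
  define c where "c E = l - e E + (if l + t < 2 * e E then q else 0)" for E
  have fX: "finite (X i)" using finite_part i by blast
  have yY: "y \<in> Y" using Yi y by blast
  have before: "pos x < pos y" if "x \<in> Y \<inter> X i" "x \<noteq> y" for x
  proof -
    have "x \<in> X i" "pos x < Suc (pos y)" using that Yi y by auto
    moreover have "pos x \<noteq> pos y" using pos_eqD[OF i \<open>x \<in> X i\<close> y(1)] that by blast
    ultimately show ?thesis by simp
  qed
  have cardY: "card (Y \<inter> X i) = l" unfolding Yi using card_initial[OF i] pos_less[OF i y(1)] y(2) by simp
  have C_tra: "E \<in> tra Y" "y \<in> E" "E \<subseteq> Y" if "E \<in> C" for E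
    using that conflicting_tra tra_subset by (auto simp: C_def)
  have finC: "finite C" using finite_tra C_tra by (meson finite_subset subsetI)
  obtain F F' where F: "F \<in> \<F>" "F' \<in> \<F>" "card (F \<inter> F' \<inter> (Y - {y})) < t"
    using nd Y by (auto simp: det_def not_le)
  have FF: "t \<le> card (F \<inter> F' \<inter> Y)" using Y F by (auto simp: det_def)
  have yF: "y \<in> F \<inter> F'"
  proof (rule ccontr)
    assume "y \<notin> F \<inter> F'"
    then have "F \<inter> F' \<inter> (Y - {y}) = F \<inter> F' \<inter> Y" by blast
    then show False using FF F by simp
  qed
  have "card (F \<inter> F' \<inter> (Y - {y})) = card (F \<inter> F' \<inter> Y) - 1"
    using yF yY finite_det[OF Y] by (simp add: Int_Diff[symmetric])
  then have "card ((F \<inter> Y) \<inter> (F' \<inter> Y)) = t" using FF F(3) by (simp add: Int_ac)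
  then have C_ne: "C \<noteq> {}" using F yF yY by (auto simp: C_def conflicting_def tra_def)
  have e_le: "e E \<le> l" if "E \<in> C" for E
    unfolding e_def cardY[symmetric] by (rule card_mono) (use fX C_tra[OF that] in auto)
  have e_b: "e E \<le> b i" if E: "E \<in> tra Y" for E
  proof -
    obtain G where G: "G \<in> \<F>" "E = G \<inter> Y" using E by (auto simp: tra_def)
    have "e E \<le> card (G \<inter> X i)" unfolding e_def by (rule card_mono) (use fX G in auto)
    then show ?thesis using H_card[OF family_H[OF G(1)] i] by simp
  qed
  have e_ge: "l + 1 \<le> e E + b i" "1 \<le> e E" if EC: "E \<in> C" for E
  proof -
    obtain E' where E': "E' \<in> tra Y" "y \<in> E'" "card (E \<inter> E') = t"
      using EC unfolding C_def conflicting_def by blast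
    have cover: "Y \<inter> X i \<subseteq> (E \<union> E') \<inter> X i"
    proof
      fix x assume x: "x \<in> Y \<inter> X i"
      show "x \<in> (E \<union> E') \<inter> X i"
      proof (rule ccontr)
        assume nx: "x \<notin> (E \<union> E') \<inter> X i"
        then have "x \<noteq> y" using x E' by blast
        then have "pos x < pos y" using before x by blast
        then have "t < card (E \<inter> E')"
          using missing_independent[OF Y i _ y(1) _ _ C_tra(1,2)[OF EC] _ E'(1,2), of x] nx x by blast
        then show False using E' by simp
      qed
    qed
    have "l + 1 \<le> card ((E \<union> E') \<inter> X i) + card (E \<inter> E' \<inter> X i)"
    proof -
      have "l \<le> card ((E \<union> E') \<inter> X i)" unfolding cardY[symmetric] by (rule card_mono) (use fX cover in auto)
      moreover have "card (E \<inter> E' \<inter> X i) \<noteq> 0" using fX E' C_tra[OF EC] y by auto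
      ultimately show ?thesis by simp
    qed
    also have "\<dots> = e E + e E'"
      unfolding e_def by (rule card_Int_Un[OF fX])
    finally show "l + 1 \<le> e E + b i" using e_b[OF E'(1)] by simp
    have "e E \<noteq> 0" unfolding e_def using fX C_tra[OF EC] y by auto
    then show "1 \<le> e E" by simp
  qed
  have le1: "(\<Sum>E\<in>C. (l - e E) * w E) \<le> (l - 1) * M"
  proof -
    let ?Z = "Y \<inter> X i - {y}"
    have fZ: "finite ?Z" using fX by simp
    have cZ: "card ?Z = l - 1" using cardY y yY fX by simp
    have "(l - e E) * w E = (\<Sum>x\<in>?Z. if x \<notin> E then w E else 0)" if "E \<in> C" for E
    proof -
      have "card {x \<in> ?Z. x \<notin> E} = card (Y \<inter> X i - E \<inter> X i)"
        by (rule arg_cong[of _ _ card]) (use C_tra[OF that] in auto)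
      also have "\<dots> = l - e E"
        unfolding e_def cardY[symmetric] by (rule card_Diff_subset) (use fX C_tra[OF that] in auto)
      finally show ?thesis using sum.inter_filter[OF fZ, of "\<lambda>_. w E" "\<lambda>x. x \<notin> E"] by simp
    qed
    then have "(\<Sum>E\<in>C. (l - e E) * w E) = (\<Sum>E\<in>C. \<Sum>x\<in>?Z. if x \<notin> E then w E else 0)" by simp
    also have "\<dots> = (\<Sum>x\<in>?Z. \<Sum>E\<in>C. if x \<notin> E then w E else 0)" by (rule sum.swap)
    also have "\<dots> \<le> (\<Sum>x\<in>?Z. M)"
    proof (rule sum_mono)
      fix x assume x: "x \<in> ?Z"
      have lt: "pos x < pos y" using before x by blast
      have "(\<Sum>E | E \<in> C \<and> x \<notin> E. w E) \<le> M"
        unfolding w_def M_def C_def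
      proof (rule independent_le[OF Y])
        fix E E' assume "E \<in> {E \<in> conflicting Y y. x \<notin> E}" "E' \<in> {E \<in> conflicting Y y. x \<notin> E}"
        then show "t < card (E \<inter> E')"
          using missing_independent[OF Y i _ y(1) lt] x conflicting_tra by blast
      qed blast
      then show "(\<Sum>E\<in>C. if x \<notin> E then w E else 0) \<le> M" by (simp add: sum.inter_filter[OF finC])
    qed
    finally show ?thesis using cZ by simp
  qed
  have le2: "(\<Sum>E\<in>C. (if l + t < 2 * e E then q else 0) * w E) \<le> q * M"
  proof -
    have "(\<Sum>E | E \<in> C \<and> l + t < 2 * e E. w E) \<le> M"
      unfolding w_def M_def C_def
    proof (rule independent_le[OF Y])
      fix E E' assume "E \<in> {E \<in> conflicting Y y. l + t < 2 * e E}" "E' \<in> {E \<in> conflicting Y y. l + t < 2 * e E}"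
      then have E: "E \<in> C" "E' \<in> C" "l + t < 2 * e E" "l + t < 2 * e E'" by (auto simp: C_def)
      have "e E + e E' = card ((E \<union> E') \<inter> X i) + card (E \<inter> E' \<inter> X i)"
        unfolding e_def by (rule card_Int_Un[OF fX, symmetric])
      moreover have "card ((E \<union> E') \<inter> X i) \<le> l"
        unfolding cardY[symmetric] by (rule card_mono) (use fX C_tra E in auto)
      moreover have "card (E \<inter> E' \<inter> X i) \<le> card (E \<inter> E')"
        by (rule card_mono) (use finite_tra_member C_tra E in auto)
      ultimately show "t < card (E \<inter> E')" using E by linarith
    qed blast
    then have "q * (\<Sum>E\<in>C. if l + t < 2 * e E then w E else 0) \<le> q * M"
      by (simp add: sum.inter_filter[OF finC])
    also have "q * (\<Sum>E\<in>C. if l + t < 2 * e E then w E else 0) = (\<Sum>E\<in>C. (if l + t < 2 * e E then q else 0) * w E)"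
      unfolding sum_distrib_left by (rule sum.cong) auto
    finally show ?thesis .
  qed
  have "(l - 1 + q) * M = (\<Sum>E\<in>C. (l - 1 + q) * m Y E)" by (simp add: M_def sum_distrib_left)
  also have "\<dots> < (\<Sum>E\<in>C. c E * w E)"
  proof (rule sum_strict_mono[OF finC C_ne])
    fix E assume E: "E \<in> C"
    let ?A = "l - 1 + q" and ?N = "card (X i) + 1 - l" and ?k = "b i + 1 - e E"
    obtain G where G: "G \<in> \<F>" "E = G \<inter> Y" using C_tra[OF E] by (auto simp: tra_def)
    then have "G \<in> traced Y E" using family_H by (auto simp: traced_def)
    then have "0 < m Y E" by (auto simp: card_gt_0_iff)
    then have w0: "0 < w E" by (simp add: w_def)
    have arith: "?A * ?k < c E * ?N"
      unfolding c_def
      by (rule removal_arith[OF t_pos l q_def]) (use e_ge[OF E] e_le[OF E] e_b[OF C_tra(1)[OF E]] part_ge[OF i] in auto)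
    have "?N * m Y E \<le> ?k * w E"
      using ratio_traced[OF i C_tra(3,2)[OF E] y(1)] cardY by (simp add: e_def w_def)
    then have "?A * (?N * m Y E) \<le> ?A * (?k * w E)" by (rule mult_left_mono) simp
    also have "\<dots> = ?A * ?k * w E" by simp
    also have "\<dots> < c E * ?N * w E" using arith w0 by simp
    finally have "?N * (?A * m Y E) < ?N * (c E * w E)" by (simp add: mult_ac)
    then show "?A * m Y E < c E * w E" by simp
  qed
  also have "\<dots> = (\<Sum>E\<in>C. (l - e E) * w E) + (\<Sum>E\<in>C. (if l + t < 2 * e E then q else 0) * w E)"
    by (simp add: c_def add_mult_distrib sum.distrib)
  finally show False using le1 le2 by (simp add: add_mult_distrib)
qed

definition box :: "nat \<Rightarrow> 'a set" where
  "box k = {x \<in> U. pos x < k}"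

lemma det_box: "det (box t)"
proof -
  define Y where "Y L = {x. \<exists>i\<in>{1..p}. x \<in> X i \<and> pos x < L i}" for L :: "nat \<Rightarrow> nat"
  define good where "good L \<longleftrightarrow> (\<forall>i\<in>{1..p}. t \<le> L i) \<and> det (Y L)" for L
  let ?L0 = "\<lambda>i. card (X i)"
  have "Y ?L0 = U" using pos_less by (auto simp: Y_def)
  moreover have "det U"
    unfolding det_def
  proof (intro conjI ballI)
    fix F F' assume F: "F \<in> \<F>" "F' \<in> \<F>"
    then have "F \<inter> F' \<inter> U = F \<inter> F'" using H_subset family_H by blast
    moreover have "t \<le> card (F \<inter> F')" using F max by (auto simp: max_family_def t_intersecting_def)
    ultimately show "t \<le> card (F \<inter> F' \<inter> U)" by simp
  qed simp
  moreover have "t \<le> card (X i)" if "i \<in> {1..p}" for i using part_gt[OF that] by simp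
  ultimately have "good ?L0" by (simp add: good_def)
  from ex_has_least_nat[of good, OF this, of "\<lambda>L. \<Sum>i\<in>{1..p}. L i"]
  obtain L where L: "good L" and least: "\<And>L'. good L' \<Longrightarrow> (\<Sum>i\<in>{1..p}. L i) \<le> (\<Sum>i\<in>{1..p}. L' i)"
    by blast
  note L = L[unfolded good_def]
  have "L i \<le> t" if i: "i \<in> {1..p}" for i
  proof (rule ccontr)
    assume "\<not> L i \<le> t"
    then have lt: "t < L i" by simp
    let ?L' = "L(i := L i - 1)"
    have "det (Y ?L')"
    proof (cases "L i \<le> card (X i)")
      case True
      then have "L i - 1 \<in> pos ` X i" using bij_betw_imp_surj_on[OF pos_bij[OF i]] lt by auto
      then obtain y where y: "y \<in> X i" "Suc (pos y) = L i" using lt by fastforce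
      have "Y L \<inter> X i = {x \<in> X i. pos x < L i}"
        unfolding Y_def using part_unique i by blast
      then have "det (Y L - {y})" using det_remove_last[OF i _ _ lt y] L by blast
      moreover have "Y L - {y} = Y ?L'"
      proof (intro equalityI subsetI)
        fix x assume "x \<in> Y L - {y}"
        then obtain j where j: "j \<in> {1..p}" "x \<in> X j" "pos x < L j" "x \<noteq> y" by (auto simp: Y_def)
        have "pos x < ?L' j"
        proof (cases "j = i")
          case True
          then have "pos x \<noteq> pos y" using pos_eqD[OF i] j y by blast
          then show ?thesis using True j y by simp
        qed (use j in simp)
        then show "x \<in> Y ?L'" using j by (auto simp: Y_def)
      next
        fix x assume "x \<in> Y ?L'"
        then obtain j where j: "j \<in> {1..p}" "x \<in> X j" "pos x < ?L' j" by (auto simp: Y_def)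
        have "pos x < L j" using j by (simp split: if_splits)
        moreover have "x \<noteq> y"
        proof
          assume xy: "x = y"
          then have "j = i" using part_unique[OF j(2) _ j(1) i] y by blast
          then show False using j(3) y xy by simp
        qed
        ultimately show "x \<in> Y L - {y}" using j by (auto simp: Y_def)
      qed
      ultimately show ?thesis by simp
    next
      case False
      have "pos x < ?L' j \<longleftrightarrow> pos x < L j" if "j \<in> {1..p}" "x \<in> X j" for j x
        using pos_less[OF that] False by auto
      then have "Y ?L' = Y L" unfolding Y_def by blast
      then show ?thesis using L by simp
    qed
    then have "good ?L'" using L lt by (auto simp: good_def)
    then have "(\<Sum>i\<in>{1..p}. L i) \<le> (\<Sum>j\<in>{1..p}. ?L' j)" by (rule least)
    moreover have "(\<Sum>j\<in>{1..p}. ?L' j) < (\<Sum>j\<in>{1..p}. L j)"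
      by (rule sum_strict_mono_ex1) (use i lt in auto)
    ultimately show False by simp
  qed
  then have "L i = t" if "i \<in> {1..p}" for i using L that by (simp add: le_antisym)
  then have "Y L = box t" unfolding Y_def box_def by auto
  then show ?thesis using L by simp
qed

end

section \<open>Stable maximum families are stars\<close>

lemma choose_le_power: "(t + j) choose t \<le> (t + 1) ^ j"
proof (induction j)
  case (Suc j)
  have "Suc j * ((t + Suc j) choose t) = (t + Suc j) * ((t + j) choose t)"
    using binomial_absorb_comp[of "t + Suc j" t] by simp
  also have "\<dots> \<le> (Suc j * (t + 1)) * (t + 1) ^ j"
    by (rule mult_mono) (use Suc in auto)
  also have "\<dots> = Suc j * (t + 1) ^ Suc j" by (simp only: power_Suc mult_ac)
  finally show ?case by (simp only: mult_le_cancel1)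
qed simp

context stable_family
begin

definition prec :: "'a \<Rightarrow> 'a \<Rightarrow> bool" where
  "prec x y \<longleftrightarrow> (\<exists>i\<in>{1..p}. x \<in> X i \<and> y \<in> X i \<and> pos x < pos y)"

definition initial :: "'a set \<Rightarrow> bool" where
  "initial S \<longleftrightarrow> (\<forall>y\<in>S. \<forall>x. prec x y \<longrightarrow> x \<in> S)"

definition core :: "'a set \<Rightarrow> 'a set" where
  "core E = {y \<in> E. \<forall>x. prec x y \<longrightarrow> x \<in> E}"

definition good :: "'a set set" where
  "good = {F \<in> \<F>. core (F \<inter> box t) \<in> tra (box t)}"

lemma prec_trans: "prec x y \<Longrightarrow> prec y z \<Longrightarrow> prec x z"
  unfolding prec_def using part_unique less_trans by blast

lemma initial_core: "initial (core E)"
  unfolding initial_def core_def using prec_trans by blast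

lemma core_subset: "core E \<subseteq> E"
  by (auto simp: core_def)

lemma initial_subset_core: "initial S \<Longrightarrow> S \<subseteq> E \<Longrightarrow> S \<subseteq> core E"
  by (auto simp: core_def initial_def)

lemma initial_Int: "initial S \<Longrightarrow> initial S' \<Longrightarrow> initial (S \<inter> S')"
  by (auto simp: initial_def)

lemma box_part: "i \<in> {1..p} \<Longrightarrow> box k \<inter> X i = {x \<in> X i. pos x < k}"
  by (auto simp: box_def)

lemma box_subset: "box k \<subseteq> U"
  by (auto simp: box_def)

lemma finite_box: "finite (box k)"
  using finite_subset[OF box_subset finite_U] .

lemma card_box_part: "i \<in> {1..p} \<Longrightarrow> card (box t \<inter> X i) = t"
  using card_initial[of i t] part_gt[of i] by (simp add: box_part)

lemma card_over_parts:
  assumes "A \<subseteq> U" and "\<And>i. i \<in> {1..p} \<Longrightarrow> card (A \<inter> X i) = k"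
  shows "card A = p * k"
proof -
  have "A = (\<Union>i\<in>{1..p}. A \<inter> X i)" using assms(1) by blast
  also have "card \<dots> = (\<Sum>i\<in>{1..p}. card (A \<inter> X i))"
  proof (rule card_UN_disjoint)
    show "\<forall>i\<in>{1..p}. \<forall>j\<in>{1..p}. i \<noteq> j \<longrightarrow> A \<inter> X i \<inter> (A \<inter> X j) = {}" using part_unique by blast
  qed (use finite_part in auto)
  finally show ?thesis using assms(2) by simp
qed

lemma card_box: "card (box t) = p * t"
  by (rule card_over_parts[OF box_subset card_box_part])

lemma card_box_Suc: "card {y \<in> box t. 0 < pos y} = p * (t - 1)"
proof (rule card_over_parts)
  fix i assume i: "i \<in> {1..p}"
  have "{y \<in> box t. 0 < pos y} \<inter> X i = {x \<in> X i. pos x < t} - {x \<in> X i. pos x < 1}"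
    using i by (auto simp: box_def)
  moreover have "{x \<in> X i. pos x < 1} \<subseteq> {x \<in> X i. pos x < t}" using t_pos by auto
  moreover have "card {x \<in> X i. pos x < t} = t" "card {x \<in> X i. pos x < 1} = 1"
    using card_initial[OF i, of t] card_initial[OF i, of 1] part_gt[OF i] t_pos by simp_all
  moreover have "finite {x \<in> X i. pos x < 1}" using finite_part[OF i] by simp
  ultimately show "card ({y \<in> box t. 0 < pos y} \<inter> X i) = t - 1"
    by (simp only: card_Diff_subset)
qed (auto simp: box_def)

lemma drop_conflicting:
  assumes i: "i \<in> {1..p}" "y \<in> X i" and E: "E \<in> tra (box t)" "y \<in> E" and drop: "E - {y} \<notin> tra (box t)"
  shows "E \<in> conflicting (box t) y"
proof (rule ccontr)
  assume nc: "E \<notin> conflicting (box t) y"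
  have fE: "finite E" using finite_tra_member[OF E(1)] .
  have meet: "t \<le> card ((E - {y}) \<inter> E')" if E': "E' \<in> tra (box t)" for E'
  proof (cases "y \<in> E'")
    case True
    then have "card (E \<inter> E') \<noteq> t" using nc E E' by (auto simp: conflicting_def)
    then have "t < card (E \<inter> E')" using tra_meet[OF det_box E(1) E'] by simp
    then have "t \<le> card (E \<inter> E' - {y})" using diff_card_le_card_Diff[of "{y}" "E \<inter> E'"] by simp
    moreover have "E \<inter> E' - {y} = (E - {y}) \<inter> E'" by blast
    ultimately show ?thesis by simp
  next
    case False
    then have "(E - {y}) \<inter> E' = E \<inter> E'" by blast
    then show ?thesis using tra_meet[OF det_box E(1) E'] by simp
  qed
  obtain F where F: "F \<in> \<F>" "E = F \<inter> box t" using E(1) by (auto simp: tra_def)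
  have fF: "finite F" using F family_H finite_member by blast
  have fX: "finite (X i)" using finite_part i by blast
  have "card ((F \<union> box t) \<inter> X i) \<le> b i + t"
    using card_Int_Un[OF fX, of F "box t"] H_card[OF family_H[OF F(1)] i(1)] card_box_part[OF i(1)] by simp
  also have "\<dots> < card (X i)" using part_gt i by blast
  finally have "\<not> X i \<subseteq> F \<union> box t" by (metis Int_absorb1 less_irrefl)
  then obtain z where z: "z \<in> X i" "z \<notin> F" "z \<notin> box t" by blast
  let ?F = "insert z (F - {y})"
  have F': "?F \<in> H" using H_swap[OF family_H[OF F(1)] i(1), of y z] z E F i by blast
  have fF': "finite ?F" using fF by simp
  have sub: "E - {y} \<subseteq> ?F" using F by blast
  have "?F \<in> \<F>"
  proof (rule max_family_extend[OF max F'])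
    fix G assume "G \<in> \<F>"
    then have "t \<le> card ((E - {y}) \<inter> (G \<inter> box t))" by (intro meet) (auto simp: tra_def)
    also have "\<dots> \<le> card (?F \<inter> G)" by (rule card_mono) (use fF' sub in auto)
    finally show "t \<le> card (?F \<inter> G)" .
  next
    have "t \<le> card ((E - {y}) \<inter> E)" using meet[OF E(1)] .
    also have "\<dots> \<le> card ?F" by (rule card_mono) (use fF' sub in auto)
    finally show "t \<le> card ?F" .
  qed
  moreover have "?F \<inter> box t = E - {y}" using F z by blast
  ultimately show False using drop by (metis imageI tra_def)
qed

lemma star_le_traced:
  assumes "E \<subseteq> box t"
  shows "2 * card (star E) \<le> 3 * m (box t) E"
proof -
  let ?Y = "box t"
  have "star E \<subseteq> traced ?Y E \<union> (\<Union>z\<in>?Y - E. star (insert z E))"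
    using assms by (auto simp: star_def traced_def)
  then have "card (star E) \<le> card (traced ?Y E \<union> (\<Union>z\<in>?Y - E. star (insert z E)))"
    by (rule card_mono[rotated]) (simp add: finite_box)
  also have "\<dots> \<le> m ?Y E + card (\<Union>z\<in>?Y - E. star (insert z E))" by (rule card_Un_le)
  also have "\<dots> \<le> m ?Y E + (\<Sum>z\<in>?Y - E. card (star (insert z E)))"
    by (intro add_left_mono card_UN_le) (simp add: finite_box)
  finally have "3 * p * t * card (star E) \<le> 3 * p * t * (m ?Y E + (\<Sum>z\<in>?Y - E. card (star (insert z E))))"
    by (rule mult_left_mono) simp
  also have "\<dots> = 3 * p * t * m ?Y E + (\<Sum>z\<in>?Y - E. 3 * p * t * card (star (insert z E)))"
    by (simp only: distrib_left sum_distrib_left)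
  also have "(\<Sum>z\<in>?Y - E. 3 * p * t * card (star (insert z E))) \<le> (\<Sum>z\<in>?Y - E. card (star E))"
  proof (rule sum_mono)
    fix z assume z: "z \<in> ?Y - E"
    then obtain i where "i \<in> {1..p}" "z \<in> X i" by (auto simp: box_def)
    then show "3 * p * t * card (star (insert z E)) \<le> card (star E)"
      using ratio_star[of i z E] z assms box_subset by blast
  qed
  also have "\<dots> = card (?Y - E) * card (star E)" by simp
  also have "\<dots> \<le> p * t * card (star E)"
    by (rule mult_right_mono) (use card_mono[OF finite_box, of "?Y - E" t] card_box in auto)
  finally have "(p * t) * (2 * card (star E)) \<le> (p * t) * (3 * m ?Y E)" by (simp add: algebra_simps)
  then show ?thesis using p_pos t_pos by simp
qed

lemma missing_le:
  assumes i: "i \<in> {1..p}" "x \<in> X i" "y \<in> X i" "pos x < pos y" and y: "y \<in> box t"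
  shows "2 * (3 * p - 1) * t * (\<Sum>E | E \<in> conflicting (box t) y \<and> x \<notin> E. card (star E)) \<le> 3 * card \<F>"
proof -
  let ?Y = "box t" and ?n = "card (X i)"
  define C where "C = {E \<in> conflicting ?Y y. x \<notin> E}"
  have C_tra: "E \<in> tra ?Y" "y \<in> E" "E \<subseteq> ?Y" "x \<notin> E" if "E \<in> C" for E
    using that conflicting_tra tra_subset unfolding C_def by blast+
  have conf_tra: "conflicting ?Y y \<subseteq> tra ?Y" by (auto simp: conflicting_def)
  have x: "x \<in> ?Y" using i y by (auto simp: box_def)
  have fX: "finite (X i)" using finite_part i by blast
  have "(?n + 1 - t) * (\<Sum>E\<in>C. m ?Y E) = (\<Sum>E\<in>C. (?n + 1 - t) * m ?Y E)" by (rule sum_distrib_left)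
  also have "\<dots> \<le> (\<Sum>E\<in>C. b i * (m ?Y E + m ?Y (E - {y})))"
  proof (rule sum_mono)
    fix E assume E: "E \<in> C"
    have "card (E \<inter> X i) \<noteq> 0" using fX C_tra[OF E] i by auto
    then have le: "(b i + 1 - card (E \<inter> X i)) * (m ?Y E + m ?Y (E - {y})) \<le> b i * (m ?Y E + m ?Y (E - {y}))"
      by (intro mult_right_mono) auto
    show "(?n + 1 - t) * m ?Y E \<le> b i * (m ?Y E + m ?Y (E - {y}))"
      by (rule order_trans[OF ratio_traced[OF i(1) C_tra(3,2)[OF E] i(3), unfolded card_box_part[OF i(1)]] le])
  qed
  also have "\<dots> = b i * (\<Sum>E\<in>C. m ?Y E + m ?Y (E - {y}))" by (rule sum_distrib_left[symmetric])
  also have "\<dots> \<le> b i * (\<Sum>E\<in>conflicting ?Y y. m ?Y E)"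
  proof (intro mult_left_mono independent_le[OF det_box])
    fix E E' assume "E \<in> C" "E' \<in> C"
    then show "t < card (E \<inter> E')" using missing_independent[OF det_box i x] C_tra by blast
  qed (auto simp: C_def)
  also have "\<dots> \<le> b i * (\<Sum>E\<in>tra ?Y. m ?Y E)"
    by (intro mult_left_mono sum_mono2) (use conf_tra finite_tra in auto)
  also have "\<dots> = b i * card \<F>" by (simp add: sum_tra[OF det_box])
  finally have le: "(?n + 1 - t) * (\<Sum>E\<in>C. m ?Y E) \<le> b i * card \<F>" .
  have "b i * ((3 * p - 1) * t) \<le> ?n + 1 - t"
  proof -
    have "t \<le> t * b i" using b_pos[OF i(1)] by simp
    moreover have "b i * ((3 * p - 1) * t) = (3 * p - 1) * t * b i" by (simp only: mult_ac)
    moreover have "(3 * p - 1) * t * b i = 3 * p * t * b i - t * b i" by (simp add: diff_mult_distrib)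
    ultimately show ?thesis using part_large[OF i(1)] by linarith
  qed
  then have "b i * ((3 * p - 1) * t) * (\<Sum>E\<in>C. m ?Y E) \<le> (?n + 1 - t) * (\<Sum>E\<in>C. m ?Y E)"
    by (rule mult_right_mono) simp
  then have "b i * ((3 * p - 1) * t * (\<Sum>E\<in>C. m ?Y E)) \<le> b i * card \<F>" using le by (simp only: mult.assoc)
  then have le': "(3 * p - 1) * t * (\<Sum>E\<in>C. m ?Y E) \<le> card \<F>" using b_pos[OF i(1)] by simp
  have "2 * (\<Sum>E\<in>C. card (star E)) \<le> 3 * (\<Sum>E\<in>C. m ?Y E)"
    unfolding sum_distrib_left by (rule sum_mono) (use star_le_traced C_tra in blast)
  then have "(3 * p - 1) * t * (2 * (\<Sum>E\<in>C. card (star E))) \<le> (3 * p - 1) * t * (3 * (\<Sum>E\<in>C. m ?Y E))"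
    by (rule mult_left_mono) simp
  also have "\<dots> = 3 * ((3 * p - 1) * t * (\<Sum>E\<in>C. m ?Y E))" by (simp only: mult_ac)
  also have "\<dots> \<le> 3 * card \<F>" using le' by simp
  finally show ?thesis by (simp only: C_def mult_ac)
qed

text \<open>If the core of a trace is not a trace, then shrinking towards the core meets a conflict at some
  \<open>y\<close> whose predecessor is already missing.\<close>

lemma bad_covered:
  assumes F: "F \<in> \<F>" "F \<notin> good"
  obtains x y i E where "i \<in> {1..p}" "x \<in> X i" "y \<in> X i" "Suc (pos x) = pos y" "y \<in> box t"
    "E \<in> conflicting (box t) y" "x \<notin> E" "F \<in> star E"
proof -
  let ?Y = "box t" and ?A = "F \<inter> box t"
  let ?P = "\<lambda>E. E \<in> tra ?Y \<and> core ?A \<subseteq> E \<and> E \<subseteq> ?A"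
  have "?P ?A" using F core_subset by (auto simp: tra_def)
  then obtain E where E: "?P E" and least: "\<And>E'. ?P E' \<Longrightarrow> card E \<le> card E'"
    using ex_has_least_nat[of ?P ?A card] by blast
  have "core ?A \<notin> tra ?Y" using F by (simp add: good_def)
  then have ne: "E - core ?A \<noteq> {}" using E by auto
  have fE: "finite E" using E finite_tra_member by blast
  obtain y where y: "y \<in> E - core ?A" and ymin: "\<And>x. x \<in> E - core ?A \<Longrightarrow> pos y \<le> pos x"
    using ex_has_least_nat[of "\<lambda>x. x \<in> E - core ?A" _ pos] ne by blast
  have yA: "y \<in> ?A" using y E by blast
  then obtain i where i: "i \<in> {1..p}" "y \<in> X i" by (auto simp: box_def)
  have "E - {y} \<notin> tra ?Y"
  proof
    assume "E - {y} \<in> tra ?Y"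
    then have "card E \<le> card (E - {y})" using least[of "E - {y}"] y E by blast
    moreover have "card (E - {y}) < card E" using fE y by (intro psubset_card_mono) auto
    ultimately show False by simp
  qed
  then have conf: "E \<in> conflicting ?Y y" using drop_conflicting[OF i] E y by blast
  have notcore: "\<exists>x. prec x y \<and> x \<notin> ?A" using y yA by (auto simp: core_def)
  then obtain u where u: "prec u y" "u \<notin> ?A" by blast
  then have pos_y: "0 < pos y" by (auto simp: prec_def)
  then have "pos y - 1 \<in> pos ` X i"
    using bij_betw_imp_surj_on[OF pos_bij[OF i(1)]] pos_less[OF i] by auto
  then obtain x where x: "x \<in> X i" "Suc (pos x) = pos y" using pos_y by force
  have "x \<notin> E"
  proof
    assume xE: "x \<in> E"
    have "x \<in> core ?A"
    proof (rule ccontr)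
      assume "x \<notin> core ?A"
      then show False using ymin[of x] x xE by simp
    qed
    obtain j where j: "j \<in> {1..p}" "u \<in> X j" "y \<in> X j" "pos u < pos y" using u by (auto simp: prec_def)
    then have ui: "u \<in> X i" using part_unique i by blast
    show False
    proof (cases "u = x")
      case True
      then show False using \<open>x \<in> core ?A\<close> core_subset u by blast
    next
      case False
      then have "pos u \<noteq> pos x" using pos_eqD[OF i(1) ui x(1)] by blast
      then have "prec u x" using ui x i j by (auto simp: prec_def)
      then show False using \<open>x \<in> core ?A\<close> u by (auto simp: core_def)
    qed
  qed
  moreover have "F \<in> star E" using E F family_H by (auto simp: star_def)
  ultimately show thesis using that[OF i(1) x(1) i(2) x(2) _ conf] yA by blast
qed

lemma card_bad: "2 * (3 * p - 1) * t * card (\<F> - good) \<le> 3 * p * (t - 1) * card \<F>"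
proof -
  let ?Y = "box t"
  define Z where "Z = {y \<in> ?Y. 0 < pos y}"
  define D where "D y = {E \<in> conflicting ?Y y. \<exists>i\<in>{1..p}. \<exists>x\<in>X i. y \<in> X i \<and> Suc (pos x) = pos y \<and> x \<notin> E}" for y
  have finZ: "finite Z" using finite_box by (simp add: Z_def)
  have finconf: "finite (conflicting ?Y y)" for y
    by (rule finite_subset[OF _ finite_tra[of ?Y]]) (auto simp: conflicting_def)
  then have finD: "finite (D y)" for y by (simp add: D_def)
  have each: "2 * (3 * p - 1) * t * (\<Sum>E\<in>D y. card (star E)) \<le> 3 * card \<F>" if y: "y \<in> Z" for y
  proof (cases "D y = {}")
    case False
    then obtain i x where x: "i \<in> {1..p}" "x \<in> X i" "y \<in> X i" "Suc (pos x) = pos y"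
      unfolding D_def by blast
    have "D y \<subseteq> {E \<in> conflicting ?Y y. x \<notin> E}"
    proof
      fix E assume "E \<in> D y"
      then obtain j x' where x': "E \<in> conflicting ?Y y" "j \<in> {1..p}" "x' \<in> X j" "y \<in> X j"
        "Suc (pos x') = pos y" "x' \<notin> E" unfolding D_def by blast
      then have "x' \<in> X i" using part_unique x by blast
      then have "x' = x" using pos_eqD[OF x(1) _ x(2), of x'] x' x by simp
      then show "E \<in> {E \<in> conflicting ?Y y. x \<notin> E}" using x' by simp
    qed
    then have "(\<Sum>E\<in>D y. card (star E)) \<le> (\<Sum>E | E \<in> conflicting ?Y y \<and> x \<notin> E. card (star E))"
      by (intro sum_mono2) (use finconf in auto)
    then have "2 * (3 * p - 1) * t * (\<Sum>E\<in>D y. card (star E)) \<le>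
      2 * (3 * p - 1) * t * (\<Sum>E | E \<in> conflicting ?Y y \<and> x \<notin> E. card (star E))"
      by (rule mult_left_mono) simp
    also have "\<dots> \<le> 3 * card \<F>" by (rule missing_le[OF x(1-3)]) (use x y in \<open>auto simp: Z_def\<close>)
    finally show ?thesis .
  qed simp
  have "\<F> - good \<subseteq> (\<Union>y\<in>Z. \<Union>E\<in>D y. star E)"
  proof
    fix F assume "F \<in> \<F> - good"
    then have "F \<in> \<F>" "F \<notin> good" by auto
    then obtain x y i E where w: "i \<in> {1..p}" "x \<in> X i" "y \<in> X i" "Suc (pos x) = pos y" "y \<in> ?Y"
      "E \<in> conflicting ?Y y" "x \<notin> E" "F \<in> star E"
      by (rule bad_covered)
    then have "y \<in> Z" by (simp add: Z_def)
    moreover have "E \<in> D y" unfolding D_def using w by blast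
    ultimately show "F \<in> (\<Union>y\<in>Z. \<Union>E\<in>D y. star E)" using w by blast
  qed
  then have "card (\<F> - good) \<le> card (\<Union>y\<in>Z. \<Union>E\<in>D y. star E)"
    by (rule card_mono[rotated]) (use finZ finD in auto)
  also have "\<dots> \<le> (\<Sum>y\<in>Z. card (\<Union>E\<in>D y. star E))" by (rule card_UN_le[OF finZ])
  also have "\<dots> \<le> (\<Sum>y\<in>Z. \<Sum>E\<in>D y. card (star E))" by (intro sum_mono card_UN_le finD)
  finally have "2 * (3 * p - 1) * t * card (\<F> - good) \<le> 2 * (3 * p - 1) * t * (\<Sum>y\<in>Z. \<Sum>E\<in>D y. card (star E))"
    by (rule mult_left_mono) simp
  also have "\<dots> = (\<Sum>y\<in>Z. 2 * (3 * p - 1) * t * (\<Sum>E\<in>D y. card (star E)))" by (rule sum_distrib_left)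
  also have "\<dots> \<le> (\<Sum>y\<in>Z. 3 * card \<F>)" by (rule sum_mono) (rule each)
  also have "\<dots> = 3 * p * (t - 1) * card \<F>" using card_box_Suc by (simp add: Z_def mult_ac)
  finally show ?thesis .
qed

lemma card_star_le:
  assumes "S \<subseteq> U" "card S = t + j"
  shows "(3 * p * t) ^ j * card (star S) \<le> card \<F>"
  using assms
proof (induction j arbitrary: S)
  case 0
  then have "t_intersecting t (star S)" using t_intersecting_star by simp
  moreover have "star S \<subseteq> H" by (auto simp: star_def)
  ultimately show ?case using max by (simp add: max_family_def)
next
  case (Suc j)
  then obtain z S' where z: "S = insert z S'" "z \<notin> S'" "card S' = t + j"
    by (metis add_Suc_right card_Suc_eq)
  then obtain i where i: "i \<in> {1..p}" "z \<in> X i" using Suc.prems by blast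
  have S': "S' \<subseteq> U" using z Suc.prems by blast
  have "(3 * p * t) ^ Suc j * card (star S) = (3 * p * t) ^ j * (3 * p * t * card (star S))"
    by (simp add: mult_ac)
  also have "\<dots> \<le> (3 * p * t) ^ j * card (star S')"
    by (rule mult_left_mono) (use ratio_star[OF i z(2) S'] z in auto)
  also have "\<dots> \<le> card \<F>" using Suc.IH S' z by blast
  finally show ?case .
qed

lemma initial_shrink:
  assumes "initial A" "A \<subseteq> U" "k \<le> card A"
  shows "\<exists>B. initial B \<and> B \<subseteq> A \<and> card B = k"
  using assms
proof (induction "card A - k" arbitrary: A)
  case 0
  then show ?case by (intro exI[of _ A]) auto
next
  case (Suc d)
  have fA: "finite A" using Suc.prems finite_subset[OF _ finite_U] by blast
  then have "Max (pos ` A) \<in> pos ` A" using Suc by (intro Max_in) auto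
  then obtain y where y: "y \<in> A" "pos y = Max (pos ` A)" by auto
  have ymax: "pos x \<le> pos y" if "x \<in> A" for x using y fA that by simp
  have "initial (A - {y})"
    unfolding initial_def
  proof (intro ballI allI impI)
    fix x u assume x: "x \<in> A - {y}" "prec u x"
    then have "u \<in> A" using Suc.prems by (auto simp: initial_def)
    moreover have "pos u < pos y" using x ymax[of x] by (auto simp: prec_def)
    ultimately show "u \<in> A - {y}" by auto
  qed
  moreover have "card (A - {y}) = card A - 1" using y fA by simp
  then have "d = card (A - {y}) - k" "k \<le> card (A - {y})" using Suc.hyps(2) by simp_all
  moreover have "A - {y} \<subseteq> U" using Suc.prems(2) by blast
  ultimately obtain B where "initial B" "B \<subseteq> A - {y}" "card B = k"
    using Suc.hyps(1)[of "A - {y}"] by blast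
  then show ?case by blast
qed

lemma good_extend:
  assumes small: "\<And>S. initial S \<Longrightarrow> S \<in> tra (box t) \<Longrightarrow> t + j \<le> card S"
    and S: "initial S" "S \<subseteq> box t" "card S + k = t + j"
  shows "(3 * p * t) ^ j * card {F \<in> good. S \<subseteq> F} \<le> p ^ k * card \<F>"
  using S
proof (induction k arbitrary: S)
  case 0
  have "{F \<in> good. S \<subseteq> F} \<subseteq> star S" using family_H by (auto simp: good_def star_def)
  then have "card {F \<in> good. S \<subseteq> F} \<le> card (star S)" by (rule card_mono[rotated]) simp
  then have "(3 * p * t) ^ j * card {F \<in> good. S \<subseteq> F} \<le> (3 * p * t) ^ j * card (star S)"
    by (rule mult_left_mono) simp
  also have "\<dots> \<le> card \<F>" by (rule card_star_le) (use 0 box_subset in auto)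
  finally show ?case by simp
next
  case (Suc k)
  let ?Y = "box t"
  define N where "N = {z \<in> ?Y - S. \<forall>x. prec x z \<longrightarrow> x \<in> S}"
  have finN: "finite N" using finite_box by (simp add: N_def)
  have fin: "finite {F \<in> good. A \<subseteq> F}" for A using finite_family by (simp add: good_def)
  define part where "part z = (SOME i. i \<in> {1..p} \<and> z \<in> X i)" for z
  have part: "part z \<in> {1..p}" "z \<in> X (part z)" if "z \<in> N" for z
  proof -
    have "\<exists>i. i \<in> {1..p} \<and> z \<in> X i" using that by (auto simp: N_def box_def)
    from someI_ex[OF this] show "part z \<in> {1..p}" "z \<in> X (part z)" by (auto simp: part_def)
  qed
  have "inj_on part N"
  proof (rule inj_onI, rule ccontr)
    fix z z' assume z: "z \<in> N" "z' \<in> N" "part z = part z'" "z \<noteq> z'"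
    note zi = part[OF z(1)] and z'i = part(2)[OF z(2), folded z(3)]
    have "pos z \<noteq> pos z'" using pos_eqD[OF zi z'i] z(4) by blast
    then have "pos z < pos z' \<or> pos z' < pos z" by linarith
    then have "prec z z' \<or> prec z' z" using zi z'i unfolding prec_def by blast
    then show False using z by (auto simp: N_def)
  qed
  moreover have "part ` N \<subseteq> {1..p}" using part by blast
  ultimately have cN: "card N \<le> p" using card_inj_on_le[of part N "{1..p}"] by simp
  have "{F \<in> good. S \<subseteq> F} \<subseteq> (\<Union>z\<in>N. {F \<in> good. insert z S \<subseteq> F})"
  proof
    fix F assume F: "F \<in> {F \<in> good. S \<subseteq> F}"
    let ?K = "core (F \<inter> ?Y)"
    have K: "?K \<in> tra ?Y" using F by (simp add: good_def)
    have SK: "S \<subseteq> ?K" using initial_subset_core[OF Suc.prems(1)] F Suc.prems(2) by blast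
    have "S \<notin> tra ?Y" using small[OF Suc.prems(1)] Suc.prems(3) by auto
    then have "?K - S \<noteq> {}" using SK K by auto
    then obtain z where z: "z \<in> ?K - S" and zmin: "\<And>x. x \<in> ?K - S \<Longrightarrow> pos z \<le> pos x"
      using ex_has_least_nat[of "\<lambda>x. x \<in> ?K - S" _ pos] by blast
    have "x \<in> S" if x: "prec x z" for x
    proof (rule ccontr)
      assume "x \<notin> S"
      moreover have "x \<in> ?K" using initial_core x z by (auto simp: initial_def)
      ultimately show False using zmin[of x] x by (auto simp: prec_def)
    qed
    moreover have "z \<in> F \<inter> ?Y" using z core_subset by blast
    ultimately have "z \<in> N" "z \<in> F" using z by (auto simp: N_def)
    then show "F \<in> (\<Union>z\<in>N. {F \<in> good. insert z S \<subseteq> F})" using F by blast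
  qed
  then have "card {F \<in> good. S \<subseteq> F} \<le> card (\<Union>z\<in>N. {F \<in> good. insert z S \<subseteq> F})"
    by (rule card_mono[rotated]) (intro finite_UN_I finN fin)
  also have "\<dots> \<le> (\<Sum>z\<in>N. card {F \<in> good. insert z S \<subseteq> F})" by (rule card_UN_le[OF finN])
  finally have "(3 * p * t) ^ j * card {F \<in> good. S \<subseteq> F} \<le>
      (3 * p * t) ^ j * (\<Sum>z\<in>N. card {F \<in> good. insert z S \<subseteq> F})" by (rule mult_left_mono) simp
  also have "\<dots> = (\<Sum>z\<in>N. (3 * p * t) ^ j * card {F \<in> good. insert z S \<subseteq> F})" by (rule sum_distrib_left)
  also have "\<dots> \<le> (\<Sum>z\<in>N. p ^ k * card \<F>)"
  proof (rule sum_mono)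
    fix z assume z: "z \<in> N"
    have "finite S" using Suc.prems finite_box finite_subset by blast
    then show "(3 * p * t) ^ j * card {F \<in> good. insert z S \<subseteq> F} \<le> p ^ k * card \<F>"
      using z Suc.prems by (intro Suc.IH) (auto simp: N_def initial_def)
  qed
  also have "\<dots> = card N * (p ^ k * card \<F>)" by simp
  also have "\<dots> \<le> p * (p ^ k * card \<F>)" by (rule mult_right_mono[OF cN]) simp
  finally show ?case by simp
qed

lemma card_good:
  assumes no: "\<And>T. T \<in> tra (box t) \<Longrightarrow> card T \<noteq> t"
  shows "3 * t * card good \<le> (t + 1) * card \<F>"
proof (cases "good = {}")
  case False
  let ?Y = "box t"
  let ?P = "\<lambda>S. initial S \<and> S \<in> tra ?Y"
  obtain F0 where "F0 \<in> good" using False by blast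
  then have "?P (core (F0 \<inter> ?Y))" using initial_core by (simp add: good_def)
  then obtain S0 where S0: "?P S0" and least: "\<And>S. ?P S \<Longrightarrow> card S0 \<le> card S"
    using ex_has_least_nat[of ?P _ card] by blast
  have "t \<le> card S0" using tra_meet[OF det_box, of S0 S0] S0 by simp
  then have "t < card S0" using no[of S0] S0 by (simp add: le_neq_implies_less)
  then obtain k where k: "card S0 = t + Suc k" using less_imp_Suc_add by fastforce
  define j where "j = Suc k"
  have S0Y: "S0 \<subseteq> ?Y" "finite S0" using S0 tra_subset finite_tra_member by blast+
  define \<T> where "\<T> = {T. T \<subseteq> S0 \<and> card T = t \<and> initial T}"
  have fT: "finite \<T>" using S0Y by (simp add: \<T>_def)
  have "\<T> \<subseteq> {T. T \<subseteq> S0 \<and> card T = t}" by (auto simp: \<T>_def)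
  then have "card \<T> \<le> card S0 choose t"
    using card_mono[of "{T. T \<subseteq> S0 \<and> card T = t}" \<T>] n_subsets[OF S0Y(2)] S0Y by simp
  then have cT: "card \<T> \<le> (t + 1) ^ j" using choose_le_power[of t j] k by (simp add: j_def)
  have fin: "finite {F \<in> good. A \<subseteq> F}" for A using finite_family by (simp add: good_def)
  have "good \<subseteq> (\<Union>T\<in>\<T>. {F \<in> good. T \<subseteq> F})"
  proof
    fix F assume F: "F \<in> good"
    let ?K = "core (F \<inter> ?Y)"
    have "t \<le> card (?K \<inter> S0)" using tra_meet[OF det_box, of ?K S0] F S0 by (simp add: good_def)
    moreover have "initial (?K \<inter> S0)" using initial_Int initial_core S0 by blast
    moreover have "?K \<inter> S0 \<subseteq> U" using S0Y box_subset by blast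
    ultimately obtain T where T: "initial T" "T \<subseteq> ?K \<inter> S0" "card T = t" using initial_shrink by blast
    then have "T \<subseteq> F" using core_subset by blast
    then show "F \<in> (\<Union>T\<in>\<T>. {F \<in> good. T \<subseteq> F})" using T F by (auto simp: \<T>_def)
  qed
  then have "card good \<le> card (\<Union>T\<in>\<T>. {F \<in> good. T \<subseteq> F})"
    by (rule card_mono[rotated]) (use fin fT in auto)
  also have "\<dots> \<le> (\<Sum>T\<in>\<T>. card {F \<in> good. T \<subseteq> F})" by (rule card_UN_le[OF fT])
  finally have "(3 * p * t) ^ j * card good \<le> (3 * p * t) ^ j * (\<Sum>T\<in>\<T>. card {F \<in> good. T \<subseteq> F})"
    by (rule mult_left_mono) simp
  also have "\<dots> = (\<Sum>T\<in>\<T>. (3 * p * t) ^ j * card {F \<in> good. T \<subseteq> F})" by (rule sum_distrib_left)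
  also have "\<dots> \<le> (\<Sum>T\<in>\<T>. p ^ j * card \<F>)"
  proof (rule sum_mono)
    fix T assume T: "T \<in> \<T>"
    show "(3 * p * t) ^ j * card {F \<in> good. T \<subseteq> F} \<le> p ^ j * card \<F>"
      by (rule good_extend) (use least k T S0Y in \<open>auto simp: j_def \<T>_def\<close>)
  qed
  also have "\<dots> = card \<T> * (p ^ j * card \<F>)" by simp
  also have "\<dots> \<le> (t + 1) ^ j * (p ^ j * card \<F>)" by (rule mult_right_mono[OF cT]) simp
  finally have "p ^ j * ((3 * t) ^ j * card good) \<le> p ^ j * ((t + 1) ^ j * card \<F>)"
    by (simp add: power_mult_distrib mult_ac)
  then have "(3 * t) ^ j * card good \<le> (t + 1) ^ j * card \<F>" using p_pos by simp
  also have "\<dots> \<le> (3 * t) ^ k * ((t + 1) * card \<F>)"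
  proof -
    have "(t + 1) ^ k \<le> (3 * t) ^ k" by (rule power_mono) (use t_pos in auto)
    then have "(t + 1) ^ k * ((t + 1) * card \<F>) \<le> (3 * t) ^ k * ((t + 1) * card \<F>)"
      by (rule mult_right_mono) simp
    then show ?thesis by (simp only: j_def power_Suc mult_ac)
  qed
  finally have "(3 * t) ^ k * (3 * t * card good) \<le> (3 * t) ^ k * ((t + 1) * card \<F>)"
    by (simp add: j_def mult_ac)
  then show ?thesis using t_pos by simp
qed simp

lemma stable_family_is_star: "\<exists>T. T \<subseteq> U \<and> card T = t \<and> \<F> = star T"
proof (cases "\<exists>T\<in>tra (box t). card T = t")
  case True
  then obtain T where T: "T \<in> tra (box t)" "card T = t" by blast
  have TU: "T \<subseteq> U" using tra_subset[OF T(1)] box_subset by blast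
  have fT: "finite T" using finite_tra_member T by blast
  have "\<F> \<subseteq> star T"
  proof
    fix F assume F: "F \<in> \<F>"
    then have "t \<le> card (F \<inter> box t \<inter> T)" by (intro tra_meet[OF det_box _ T(1)]) (auto simp: tra_def)
    then have "F \<inter> box t \<inter> T = T" by (intro card_seteq[OF fT]) (use T in auto)
    then show "F \<in> star T" using F family_H by (auto simp: star_def)
  qed
  moreover have "card (star T) \<le> card \<F>"
    using max t_intersecting_star[OF T(2) TU] by (auto simp: max_family_def star_def)
  ultimately have "\<F> = star T" by (intro card_seteq) auto
  then show ?thesis using T TU by blast
next
  case False
  then have no: "card T \<noteq> t" if "T \<in> tra (box t)" for T using that by blast
  have pos: "0 < card \<F>" using max_family_nonempty max .
  have p2: "2 \<le> p"
  proof (rule ccontr)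
    assume "\<not> 2 \<le> p"
    then have p1: "p = 1" using p_pos by simp
    obtain F where F: "F \<in> \<F>" using pos by fastforce
    let ?E = "F \<inter> box t"
    have E: "?E \<in> tra (box t)" using F by (auto simp: tra_def)
    have "t \<le> card ?E" using tra_meet[OF det_box E E] by simp
    moreover have "card ?E \<le> t" using card_mono[OF finite_box, of ?E t] card_box p1 by simp
    ultimately show False using no[OF E] by simp
  qed
  define f g where "f = card good" and "g = card (\<F> - good)"
  have "good \<subseteq> \<F>" by (auto simp: good_def)
  then have sum: "card \<F> = f + g"
    unfolding f_def g_def using finite_family
    using card_mono[of \<F> good] by (simp add: card_Diff_subset finite_subset)
  have "3 * t * f \<le> (t + 1) * card \<F>" unfolding f_def by (rule card_good[OF no])
  then have f: "15 * (t * f) \<le> 5 * (t * card \<F>) + 5 * card \<F>" by (simp add: algebra_simps)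
  have "5 * p \<le> 2 * (3 * p - 1)" using p2 by simp
  then have "5 * p * (t * g) \<le> 2 * (3 * p - 1) * (t * g)" by (rule mult_right_mono) simp
  also have "\<dots> \<le> 3 * p * (t - 1) * card \<F>" using card_bad by (simp add: g_def mult_ac)
  finally have "p * (5 * (t * g)) \<le> p * (3 * (t - 1) * card \<F>)" by (simp add: mult_ac)
  then have "5 * (t * g) \<le> 3 * (t - 1) * card \<F>" using p_pos by simp
  moreover obtain s where s: "t = Suc s" using t_pos by (cases t) auto
  ultimately have "5 * (t * g) + 3 * card \<F> \<le> 3 * (t * card \<F>)" by (simp add: algebra_simps)
  moreover have "t * card \<F> = t * f + t * g" using sum by (simp add: algebra_simps)
  moreover have "card \<F> \<le> t * card \<F>" using t_pos by simp
  ultimately show ?thesis using f pos by linarith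
qed

end

section \<open>Shifting\<close>

lemma card_exchange:
  assumes "finite S" "y \<in> S" "x \<notin> S"
  shows "card (insert x (S - {y})) = card S"
  using assms card_Suc_Diff1[of S y] by simp

context partite_family
begin

definition push :: "'a \<Rightarrow> 'a \<Rightarrow> 'a set set \<Rightarrow> 'a set \<Rightarrow> 'a set" where
  "push x y \<F> A = (if y \<in> A \<and> x \<notin> A \<and> insert x (A - {y}) \<notin> \<F> then insert x (A - {y}) else A)"

lemma push_cases:
  obtains "push x y \<F> A = A" "y \<in> A \<Longrightarrow> x \<notin> A \<Longrightarrow> insert x (A - {y}) \<in> \<F>"
  | "push x y \<F> A = insert x (A - {y})" "y \<in> A" "x \<notin> A" "insert x (A - {y}) \<notin> \<F>"
  unfolding push_def by (cases "y \<in> A \<and> x \<notin> A \<and> insert x (A - {y}) \<notin> \<F>") auto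

lemma inj_on_push: "inj_on (push x y \<F>) \<F>"
proof (rule inj_onI)
  fix A B assume AB: "A \<in> \<F>" "B \<in> \<F>" "push x y \<F> A = push x y \<F> B"
  have undo: "insert y (insert x (C - {y}) - {x}) = C" if "y \<in> C" "x \<notin> C" for C using that by blast
  show "A = B"
    using AB undo[of A] undo[of B] by (cases rule: push_cases[of x y \<F> A]; cases rule: push_cases[of x y \<F> B]) metis+
qed

lemma push_H:
  assumes "\<F> \<subseteq> H" "i \<in> {1..p}" "x \<in> X i" "y \<in> X i" "A \<in> \<F>"
  shows "push x y \<F> A \<in> H"
  using assms H_swap[of A i y x] unfolding push_def by auto

lemma push_meet:
  assumes F: "\<F> \<subseteq> H" "t_intersecting t \<F>" and AB: "A \<in> \<F>" "B \<in> \<F>"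
    and A: "y \<in> A" "x \<notin> A" and B: "y \<in> B \<Longrightarrow> x \<notin> B \<Longrightarrow> insert x (B - {y}) \<in> \<F>"
  shows "t \<le> card (insert x (A - {y}) \<inter> B)"
proof (cases "y \<in> B")
  case True
  have fin: "finite (A \<inter> B)" using F AB finite_member by blast
  show ?thesis
  proof (cases "x \<in> B")
    case xB: True
    then have "insert x (A - {y}) \<inter> B = insert x (A \<inter> B - {y})" by blast
    moreover have "card (insert x (A \<inter> B - {y})) = card (A \<inter> B)"
      by (rule card_exchange[OF fin]) (use A True in auto)
    ultimately have "card (insert x (A - {y}) \<inter> B) = card (A \<inter> B)" by simp
    then show ?thesis using F AB by (simp add: t_intersecting_def)
  next
    case False
    then have "insert x (A - {y}) \<inter> B = A \<inter> insert x (B - {y})" using A by blast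
    then show ?thesis using F(2) AB(1) B[OF True False] by (simp add: t_intersecting_def)
  qed
next
  case False
  have "t \<le> card (A \<inter> B)" using F AB by (simp add: t_intersecting_def)
  also have "\<dots> \<le> card (insert x (A - {y}) \<inter> B)"
    by (rule card_mono) (use False F AB finite_member in auto)
  finally show ?thesis .
qed

lemma t_intersecting_push:
  assumes F: "\<F> \<subseteq> H" "t_intersecting t \<F>"
  shows "t_intersecting t (push x y \<F> ` \<F>)"
proof -
  have "t \<le> card (push x y \<F> A \<inter> push x y \<F> B)" if AB: "A \<in> \<F>" "B \<in> \<F>" for A B
  proof (cases rule: push_cases[of x y \<F> A])
    case A: 1
    show ?thesis
    proof (cases rule: push_cases[of x y \<F> B])
      case B: 1
      show ?thesis unfolding A(1) B(1) using F AB by (simp add: t_intersecting_def)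
    next
      case B: 2
      show ?thesis unfolding A(1) B(1)
        using push_meet[OF F AB(2,1) B(2,3) A(2)] by (simp add: Int_commute)
    qed
  next
    case A: 2
    show ?thesis
    proof (cases rule: push_cases[of x y \<F> B])
      case B: 1
      show ?thesis unfolding A(1) B(1) by (rule push_meet[OF F AB A(2,3) B(2)])
    next
      case B: 2
      have "insert x (A - {y}) \<inter> insert x (B - {y}) = insert x (A \<inter> B - {y})" by blast
      moreover have "finite (A \<inter> B)" using F AB finite_member by blast
      moreover from this have "card (insert x (A \<inter> B - {y})) = card (A \<inter> B)"
        by (rule card_exchange) (use A B in auto)
      ultimately have "card (insert x (A - {y}) \<inter> insert x (B - {y})) = card (A \<inter> B)" by simp
      then show ?thesis unfolding A(1) B(1) using F AB by (simp add: t_intersecting_def)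
    qed
  qed
  then show ?thesis by (auto simp: t_intersecting_def)
qed

lemma max_family_push:
  assumes max: "max_family \<F>" and i: "i \<in> {1..p}" "x \<in> X i" "y \<in> X i"
  shows "max_family (push x y \<F> ` \<F>)"
proof -
  have F: "\<F> \<subseteq> H" "t_intersecting t \<F>" using max by (auto simp: max_family_def)
  have "push x y \<F> ` \<F> \<subseteq> H" using push_H[OF F(1) i] by blast
  then show ?thesis
    using max t_intersecting_push[OF F] card_image[OF inj_on_push] by (simp add: max_family_def)
qed

lemma max_family_star_eq:
  assumes max: "max_family \<F>" and T: "T \<subseteq> U" "card T = t" and sub: "\<F> \<subseteq> star T"
  shows "\<F> = star T"
proof (rule card_seteq)
  show "card (star T) \<le> card \<F>"
    using max t_intersecting_star[OF T(2,1)] by (auto simp: max_family_def star_def)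
qed (use sub in auto)

text \<open>The graph joining members of \<open>star T\<close> that meet only in \<open>T\<close> is connected, since \<open>3 b\<^sub>i \<le> n\<^sub>i\<close>.\<close>

lemma star_common_neighbour:
  assumes i: "i \<in> {1..p}" "x \<in> X i" "y \<in> X i" and T: "x \<in> T" "y \<notin> T"
    and A: "A \<in> star T" "y \<notin> A" and A': "A' \<in> star T" "y \<notin> A'"
  shows "\<exists>D. D \<in> star T \<and> y \<notin> D \<and> D \<inter> (A \<union> A') = T"
proof -
  let ?B = "A \<union> A'"
  let ?P = "\<lambda>D. D \<in> star T \<and> y \<notin> D"
  have "?P A" using A by simp
  then obtain D where D: "?P D" and least: "\<And>D'. ?P D' \<Longrightarrow> card (D \<inter> ?B - T) \<le> card (D' \<inter> ?B - T)"
    using ex_has_least_nat[of ?P A "\<lambda>D. card (D \<inter> ?B - T)"] by blast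
  have H: "A \<in> H" "A' \<in> H" "D \<in> H" "T \<subseteq> D" "T \<subseteq> ?B" "x \<in> A \<inter> A'"
    using A A' D T by (auto simp: star_def)
  have "D \<inter> ?B - T = {}"
  proof (rule ccontr)
    assume "D \<inter> ?B - T \<noteq> {}"
    then obtain u where u: "u \<in> D" "u \<in> ?B" "u \<notin> T" by blast
    then obtain j where j: "j \<in> {1..p}" "u \<in> X j" using H_subset[OF H(3)] by blast
    have fX: "finite (X j)" using finite_part j by blast
    have "card (insert y ?B \<inter> X j) \<le> 2 * b j"
    proof -
      have c: "card (?B \<inter> X j) + card (A \<inter> A' \<inter> X j) \<le> 2 * b j"
        using card_Int_Un[OF fX, of A A'] H_card[OF H(1) j(1)] H_card[OF H(2) j(1)] by simp
      show ?thesis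
      proof (cases "y \<in> X j")
        case True
        then have "x \<in> X j" using part_unique i j by blast
        then have "card (A \<inter> A' \<inter> X j) \<noteq> 0" using fX H by auto
        moreover have "insert y ?B \<inter> X j = insert y (?B \<inter> X j)" using True by blast
        ultimately show ?thesis using c card_insert_le_m1[of "2 * b j" "?B \<inter> X j" y] b_pos[OF j(1)] by simp
      next
        case False
        then have "insert y ?B \<inter> X j = ?B \<inter> X j" by blast
        then show ?thesis using c by simp
      qed
    qed
    moreover have "card (D \<inter> X j - {u}) \<le> b j - 1" using H_card[OF H(3) j(1)] u j by simp
    moreover have "card (insert y ?B \<inter> X j \<union> (D \<inter> X j - {u})) \<le> card (insert y ?B \<inter> X j) + card (D \<inter> X j - {u})"
      by (rule card_Un_le)
    ultimately have "card (insert y ?B \<inter> X j \<union> (D \<inter> X j - {u})) < card (X j)"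
      using part_gt(2)[OF j(1)] b_pos[OF j(1)] by linarith
    then obtain z where z: "z \<in> X j" "z \<notin> insert y ?B \<inter> X j \<union> (D \<inter> X j - {u})"
      by (metis card_mono finite_Int finite_Diff finite_UnI fX linorder_not_less subsetI)
    then have z': "z \<notin> ?B" "z \<noteq> y" "z \<notin> D" using u by auto
    let ?D = "insert z (D - {u})"
    have "?D \<in> H" using H_swap[OF H(3) j(1), of u z] u j z z' by blast
    then have "?P ?D" using H u z' D by (auto simp: star_def)
    then have "card (D \<inter> ?B - T) \<le> card (?D \<inter> ?B - T)" by (rule least)
    also have "\<dots> < card (D \<inter> ?B - T)"
      by (rule psubset_card_mono) (use u z' finite_member[OF H(3)] in auto)
    finally show False by simp
  qed
  then have "D \<inter> ?B = T" using H by blast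
  then show ?thesis using D by blast
qed

text \<open>For \<open>x \<in> T\<close> and \<open>y \<notin> T\<close>, each member \<open>A\<close> of \<open>star T\<close> avoiding \<open>y\<close> comes from exactly one of \<open>A\<close>
  and \<open>A - x + y\<close>; by connectedness the choice does not depend on \<open>A\<close>.\<close>

lemma push_star_imp_star:
  assumes max: "max_family \<F>" and i: "i \<in> {1..p}" "x \<in> X i" "y \<in> X i" "x \<noteq> y"
    and T: "T \<subseteq> U" "card T = t" and eq: "push x y \<F> ` \<F> = star T"
  shows "\<exists>T'. T' \<subseteq> U \<and> card T' = t \<and> \<F> = star T'"
proof -
  have FH: "\<F> \<subseteq> H" and tint: "t_intersecting t \<F>" using max by (auto simp: max_family_def)
  have pushed: "push x y \<F> A \<in> star T" if "A \<in> \<F>" for A using eq that by blast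
  have stay: "A \<in> star T" if "A \<in> \<F>" "y \<in> A \<Longrightarrow> x \<notin> A \<Longrightarrow> insert x (A - {y}) \<in> \<F>" for A
    using pushed[OF that(1)] that(2) by (auto simp: push_def split: if_splits)
  have origin: "(A \<in> \<F> \<and> (y \<in> A \<longrightarrow> x \<notin> A \<longrightarrow> insert x (A - {y}) \<in> \<F>)) \<or>
      (A \<notin> \<F> \<and> x \<in> A \<and> y \<notin> A \<and> insert y (A - {x}) \<in> \<F>)" if A: "A \<in> star T" for A
  proof -
    obtain B where B: "B \<in> \<F>" "A = push x y \<F> B" using A eq by blast
    show ?thesis
    proof (cases rule: push_cases[of x y \<F> B])
      case 1
      then show ?thesis using B by simp
    next
      case 2
      have "insert y (insert x (B - {y}) - {x}) = B" using 2 by blast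
      then show ?thesis using 2 B i(4) by auto
    qed
  qed
  have y_notin: "y \<notin> T" if A: "A \<in> star T" "y \<in> A" "x \<notin> A" for A
  proof -
    have "insert x (A - {y}) \<in> \<F>" using origin[OF A(1)] A by blast
    then have "insert x (A - {y}) \<in> star T" by (rule stay) simp
    then show ?thesis using i(4) by (auto simp: star_def)
  qed
  consider "x \<in> T \<longleftrightarrow> y \<in> T" | "x \<notin> T" "y \<in> T" | "x \<in> T" "y \<notin> T" by blast
  then show ?thesis
  proof cases
    case 1
    have "A \<in> star T" if A: "A \<in> \<F>" for A
    proof (cases rule: push_cases[of x y \<F> A])
      case 1
      then show ?thesis using pushed[OF A] by simp
    next
      case 2
      then have "T \<subseteq> insert x (A - {y})" using pushed[OF A] by (simp add: star_def)
      then have "T \<subseteq> A" using \<open>x \<in> T \<longleftrightarrow> y \<in> T\<close> i(4) by blast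
      then show ?thesis using A FH by (auto simp: star_def)
    qed
    then have "\<F> = star T" by (intro max_family_star_eq[OF max T] subsetI)
    then show ?thesis using T by blast
  next
    case 2
    have "0 < card (star T)"
      using max_family_nonempty[OF max] card_image[OF inj_on_push, of x y \<F>] eq by simp
    then have "star T \<noteq> {}" by auto
    then obtain A where A: "A \<in> star T" by blast
    have AH: "A \<in> H" "T \<subseteq> A" using A by (auto simp: star_def)
    have "card (A \<inter> X i) < card (X i)" using H_card[OF AH(1) i(1)] part_gt[OF i(1)] by simp
    then have "A \<inter> X i \<noteq> X i" by auto
    then obtain z where z: "z \<in> X i" "z \<notin> A" by blast
    have "\<exists>A\<in>star T. x \<notin> A"
    proof (cases "x \<in> A")
      case True
      have "x \<in> A \<inter> X i" "z \<in> X i - A" using True z i(2) by blast+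
      then have "insert z (A - {x}) \<in> H" by (rule H_swap[OF AH(1) i(1)])
      moreover have "T \<subseteq> insert z (A - {x})" using AH(2) 2(1) by blast
      ultimately have "insert z (A - {x}) \<in> star T" by (simp add: star_def)
      moreover have "x \<notin> insert z (A - {x})" using z(2) True by blast
      ultimately show ?thesis by (rule bexI[rotated])
    next
      case False
      then show ?thesis using A by (rule bexI)
    qed
    then obtain B where B: "B \<in> star T" "x \<notin> B" by (elim bexE)
    then have "y \<in> B" using 2(2) by (auto simp: star_def)
    then have "y \<notin> T" using B by (intro y_notin)
    then show ?thesis using 2(2) by simp
  next
    case 3
    let ?T' = "insert y (T - {x})"
    have fT: "finite T" using finite_subset[OF T(1) finite_U] .
    have T': "?T' \<subseteq> U" using T(1) i by blast
    have T'_card: "card ?T' = t" using card_exchange[OF fT 3] T(2) by (rule trans)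
    have disagree: False
      if A: "A \<in> star T" "y \<notin> A" "A \<in> \<F>" and B: "B \<in> star T" "y \<notin> B" "B \<notin> \<F>" for A B
    proof -
      obtain D where D: "D \<in> star T" "y \<notin> D" "D \<inter> (A \<union> B) = T"
        using star_common_neighbour[OF i(1-3) 3 A(1,2) B(1,2)] by blast
      have small: "card (T - {x}) < t" using T 3 fT card_Diff1_less by metis
      have "C \<inter> insert y (C' - {x}) = T - {x}" if "C \<inter> C' = T" "y \<notin> C" for C C' using that by blast
      moreover have "T \<subseteq> A" "T \<subseteq> B" using A B by (auto simp: star_def)
      then have "D \<inter> B = T" "A \<inter> D = T" using D(3) D(1) by (auto simp: star_def)
      ultimately have "D \<inter> insert y (B - {x}) = T - {x}" "A \<inter> insert y (D - {x}) = T - {x}"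
        using A D by blast+
      moreover have "insert y (B - {x}) \<in> \<F>" using origin[OF B(1)] B by blast
      moreover have "D \<in> \<F> \<or> insert y (D - {x}) \<in> \<F>" using origin[OF D(1)] by blast
      ultimately have "t \<le> card (T - {x})" using tint A(3) unfolding t_intersecting_def by metis
      then show False using small by simp
    qed
    show ?thesis
    proof (cases "\<exists>A\<in>star T. y \<notin> A \<and> A \<in> \<F>")
      case True
      have "A \<in> star T" if A: "A \<in> \<F>" for A
      proof (cases rule: push_cases[of x y \<F> A])
        case 1
        then show ?thesis using pushed[OF A] by simp
      next
        case 2
        then have "insert x (A - {y}) \<in> star T" using pushed[OF A] by simp
        moreover have "y \<notin> insert x (A - {y})" using i(4) by simp
        ultimately show ?thesis using disagree True 2(4) by blast
      qed
      then have "\<F> = star T" by (intro max_family_star_eq[OF max T] subsetI)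
    then show ?thesis using T by blast
    next
      case False
      have "A \<in> star ?T'" if A: "A \<in> \<F>" for A
      proof (cases rule: push_cases[of x y \<F> A])
        case 1
        then have "A \<in> star T" using pushed[OF A] by simp
        then show ?thesis using False A by (auto simp: star_def)
      next
        case 2
        then have "T \<subseteq> insert x (A - {y})" using pushed[OF A] by (simp add: star_def)
        then show ?thesis using 2 A FH by (auto simp: star_def)
      qed
      then have "\<F> = star ?T'" by (intro max_family_star_eq[OF max T' T'_card] subsetI)
      then show ?thesis using T' T'_card by blast
    qed
  qed
qed

lemma ordering_exists:
  "\<exists>pos :: 'a \<Rightarrow> nat. \<forall>i\<in>{1..p}. bij_betw pos (X i) {..<card (X i)}"
proof -
  have "\<forall>i\<in>{1..p}. \<exists>h. bij_betw h (X i) {..<card (X i)}"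
    using ex_bij_betw_finite_nat[OF finite_part] by (simp add: atLeast0LessThan)
  from bchoice[OF this] obtain h where h: "\<And>i. i \<in> {1..p} \<Longrightarrow> bij_betw (h i) (X i) {..<card (X i)}" by blast
  define pos where "pos x = h (SOME i. i \<in> {1..p} \<and> x \<in> X i) x" for x
  have "bij_betw pos (X i) {..<card (X i)}" if i: "i \<in> {1..p}" for i
  proof -
    have "pos x = h i x" if "x \<in> X i" for x
    proof -
      have "(SOME i. i \<in> {1..p} \<and> x \<in> X i) = i"
        using i that part_unique by (intro some_equality) blast+
      then show ?thesis by (simp add: pos_def)
    qed
    then show ?thesis using h[OF i] bij_betw_cong[of "X i" pos "h i"] by simp
  qed
  then show ?thesis by blast
qed

lemma max_family_is_star:
  assumes "max_family \<F>"
  shows "\<exists>T. T \<subseteq> U \<and> card T = t \<and> \<F> = star T"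
proof -
  obtain pos :: "'a \<Rightarrow> nat" where pos: "\<And>i. i \<in> {1..p} \<Longrightarrow> bij_betw pos (X i) {..<card (X i)}"
    using ordering_exists by blast
  define weight where "weight A = (\<Sum>a\<in>A. pos a)" for A
  show ?thesis using assms
  proof (induction "\<Sum>A\<in>\<F>. weight A" arbitrary: \<F> rule: less_induct)
    case less
    have FH: "\<F> \<subseteq> H" using less.prems by (auto simp: max_family_def)
    have finF: "finite \<F>" using FH finite_H finite_subset by blast
    show ?case
    proof (cases "\<exists>i x y A. i \<in> {1..p} \<and> x \<in> X i \<and> y \<in> X i \<and> pos x < pos y \<and> A \<in> \<F> \<and> y \<in> A \<and> x \<notin> A
        \<and> insert x (A - {y}) \<notin> \<F>")
      case True
      then obtain i x y A where i: "i \<in> {1..p}" "x \<in> X i" "y \<in> X i" and lt: "pos x < pos y"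
        and A: "A \<in> \<F>" "y \<in> A" "x \<notin> A" "insert x (A - {y}) \<notin> \<F>" by blast
      let ?f = "push x y \<F>"
      have moved: "weight (insert x (B - {y})) < weight B" if "B \<in> \<F>" "y \<in> B" "x \<notin> B" for B
      proof -
        have "finite B" using that FH finite_member by blast
        then have "weight (insert x (B - {y})) = pos x + (\<Sum>a\<in>B - {y}. pos a)" "weight B = pos y + (\<Sum>a\<in>B - {y}. pos a)"
          using that by (auto simp: weight_def sum.remove)
        then show ?thesis using lt by simp
      qed
      have "(\<Sum>B\<in>?f ` \<F>. weight B) = (\<Sum>B\<in>\<F>. weight (?f B))"
        by (rule sum.reindex_cong[OF inj_on_push refl refl])
      also have "\<dots> < (\<Sum>B\<in>\<F>. weight B)"
      proof (rule sum_strict_mono_ex1[OF finF])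
        show "\<forall>B\<in>\<F>. weight (?f B) \<le> weight B"
        proof
          fix B assume B: "B \<in> \<F>"
          show "weight (?f B) \<le> weight B"
            by (cases rule: push_cases[of x y \<F> B]) (use moved[OF B] in simp_all)
        qed
        show "\<exists>B\<in>\<F>. weight (?f B) < weight B"
          using A moved[OF A(1-3)] by (intro bexI[OF _ A(1)]) (simp add: push_def)
      qed
      finally obtain T where T: "T \<subseteq> U" "card T = t" "?f ` \<F> = star T"
        using less.hyps[OF _ max_family_push[OF less.prems i]] by blast
      have "x \<noteq> y" using lt by blast
      then show ?thesis by (rule push_star_imp_star[OF less.prems i _ T])
    next
      case False
      interpret stable_family p t X b H pos \<F>
      proof
        show "bij_betw pos (X i) {..<card (X i)}" if "i \<in> {1..p}" for i using pos that .
        show "max_family \<F>" by (rule less.prems)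
        show "insert x (A - {y}) \<in> \<F>"
          if "i \<in> {1..p}" "x \<in> X i" "y \<in> X i" "pos x < pos y" "A \<in> \<F>" "y \<in> A" "x \<notin> A" for i x y A
          using False that by blast
      qed
      show ?thesis by (rule stable_family_is_star)
    qed
  qed
qed

lemma max_family_exists: "\<exists>\<F>. max_family \<F>"
proof -
  define P where "P \<G> \<longleftrightarrow> \<G> \<subseteq> H \<and> t_intersecting t \<G>" for \<G>
  have "P {}" by (simp add: P_def t_intersecting_def)
  moreover have "\<forall>\<G>. P \<G> \<longrightarrow> card \<G> < Suc (card H)"
    using card_mono[OF finite_H] by (simp add: P_def less_Suc_eq_le)
  ultimately obtain \<G> where "P \<G>" "\<forall>\<G>'. P \<G>' \<longrightarrow> card \<G>' \<le> card \<G>"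
    using ex_has_greatest_nat[of P "{}" card "Suc (card H)"] by blast
  then have "max_family \<G>" by (simp add: max_family_def P_def)
  then show ?thesis by blast
qed

end

section \<open>Stars and the bound\<close>

lemma layers_exchange:
  assumes fin: "\<And>i. i \<in> {1..p} \<Longrightarrow> finite (X i)" and disj: "disjoint_family_on X {1..p}"
    and F: "F \<in> layers p X R" and i: "i \<in> {1..p}" and y: "y \<in> F \<inter> X i" and z: "z \<in> X i - F"
  shows "insert z (F - {y}) \<in> layers p X R"
proof -
  obtain r where r: "r \<in> R" "F \<in> layer p X r" using F by (auto simp: layers_def)
  have "card (insert z (F - {y}) \<inter> X j) = r j" if j: "j \<in> {1..p}" for j
  proof (cases "j = i")
    case True
    have "insert z (F - {y}) \<inter> X i = insert z (F \<inter> X i - {y})" using z by blast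
    then show ?thesis
      using card_exchange[of "F \<inter> X i" y z] fin[OF i] y z r i True by (simp add: layer_def)
  next
    case False
    then have "X i \<inter> X j = {}" using disj i j by (simp add: disjoint_family_on_def)
    then have "insert z (F - {y}) \<inter> X j = F \<inter> X j" using y z by blast
    then show ?thesis using r j by (simp add: layer_def)
  qed
  then have "insert z (F - {y}) \<in> layer p X r" using r i z unfolding layer_def by blast
  then show ?thesis using r by (auto simp: layers_def)
qed

lemma layers_large_member:
  assumes fin: "\<And>i. i \<in> {1..p} \<Longrightarrow> finite (X i)" and disj: "disjoint_family_on X {1..p}"
    and r: "r \<in> R" "\<And>i. i \<in> {1..p} \<Longrightarrow> r i \<le> card (X i)"
  shows "\<exists>F\<in>layers p X R. card F = (\<Sum>i\<in>{1..p}. r i)"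
proof -
  have "\<forall>i\<in>{1..p}. \<exists>A. A \<subseteq> X i \<and> card A = r i"
    using r(2) by (metis obtain_subset_with_card_n)
  then obtain G where G: "\<And>i. i \<in> {1..p} \<Longrightarrow> G i \<subseteq> X i \<and> card (G i) = r i" by metis
  let ?F = "\<Union>i\<in>{1..p}. G i"
  have sep: "X i \<inter> X j = {}" if "i \<in> {1..p}" "j \<in> {1..p}" "i \<noteq> j" for i j
    using disj that by (simp add: disjoint_family_on_def)
  have "?F \<inter> X j = G j" if "j \<in> {1..p}" for j
    using G that sep by blast
  then have "?F \<in> layer p X r" using G unfolding layer_def by fastforce
  moreover have "card ?F = (\<Sum>i\<in>{1..p}. card (G i))"
  proof (rule card_UN_disjoint)
    show "\<forall>i\<in>{1..p}. finite (G i)" using G fin finite_subset by blast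
    show "\<forall>i\<in>{1..p}. \<forall>j\<in>{1..p}. i \<noteq> j \<longrightarrow> G i \<inter> G j = {}" using G sep by blast
  qed simp
  ultimately show ?thesis using r G by (auto simp: layers_def intro!: bexI[of _ ?F])
qed

lemma card_layer_star_le:
  assumes fin: "\<And>i. i \<in> {1..p} \<Longrightarrow> finite (X i)" and T: "T \<subseteq> (\<Union>i\<in>{1..p}. X i)"
    and r: "\<And>i. i \<in> {1..p} \<Longrightarrow> r i \<le> card (X i)"
  shows "card {F \<in> layer p X r. T \<subseteq> F} \<le>
    (\<Prod>i\<in>{1..p}. binom (int (card (X i)) - int (card (T \<inter> X i))) (int (r i) - int (card (T \<inter> X i))))"
proof (cases "{F \<in> layer p X r. T \<subseteq> F} = {}")
  case False
  let ?s = "\<lambda>i. card (T \<inter> X i)"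
  let ?P = "\<Pi>\<^sub>E i\<in>{1..p}. {A. A \<subseteq> X i - T \<and> card A = r i - ?s i}"
  obtain F0 where F0: "F0 \<in> layer p X r" "T \<subseteq> F0" using False by blast
  have sr: "?s i \<le> r i" if i: "i \<in> {1..p}" for i
  proof -
    have "?s i \<le> card (F0 \<inter> X i)" by (rule card_mono) (use fin[OF i] F0 in auto)
    then show ?thesis using F0 i by (simp add: layer_def)
  qed
  let ?f = "\<lambda>F. \<lambda>i\<in>{1..p}. F \<inter> X i - T"
  have "card {F \<in> layer p X r. T \<subseteq> F} \<le> card ?P"
  proof (rule card_inj_on_le[where f = ?f])
    show "inj_on ?f {F \<in> layer p X r. T \<subseteq> F}"
    proof (rule inj_onI)
      fix F F' assume F: "F \<in> {F \<in> layer p X r. T \<subseteq> F}" "F' \<in> {F \<in> layer p X r. T \<subseteq> F}" "?f F = ?f F'"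
      have rec: "F = T \<union> (\<Union>i\<in>{1..p}. F \<inter> X i - T)" if "F \<in> {F \<in> layer p X r. T \<subseteq> F}" for F
        using that unfolding layer_def by blast
      have "F \<inter> X i - T = F' \<inter> X i - T" if "i \<in> {1..p}" for i
        using fun_cong[OF F(3), of i] that by simp
      then have "(\<Union>i\<in>{1..p}. F \<inter> X i - T) = (\<Union>i\<in>{1..p}. F' \<inter> X i - T)" by simp
      then show "F = F'" using rec[OF F(1)] rec[OF F(2)] by simp
    qed
    show "?f ` {F \<in> layer p X r. T \<subseteq> F} \<subseteq> ?P"
    proof
      fix g assume "g \<in> ?f ` {F \<in> layer p X r. T \<subseteq> F}"
      then obtain F where F: "F \<in> layer p X r" "T \<subseteq> F" "g = ?f F" by blast
      have "card (F \<inter> X i - T) = r i - ?s i" if i: "i \<in> {1..p}" for i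
      proof -
        have "F \<inter> X i - T = F \<inter> X i - T \<inter> X i" by blast
        also have "card \<dots> = card (F \<inter> X i) - ?s i"
          by (rule card_Diff_subset) (use fin[OF i] F in auto)
        finally show ?thesis using F i by (simp add: layer_def)
      qed
      then show "g \<in> ?P" using F(3) by (auto intro!: PiE_I)
    qed
    show "finite ?P" by (rule finite_PiE) (use fin in auto)
  qed
  also have "card ?P = (\<Prod>i\<in>{1..p}. card {A. A \<subseteq> X i - T \<and> card A = r i - ?s i})"
    by (rule card_PiE) simp
  also have "\<dots> = (\<Prod>i\<in>{1..p}. binom (int (card (X i)) - int (?s i)) (int (r i) - int (?s i)))"
  proof (rule prod.cong[OF refl])
    fix i assume i: "i \<in> {1..p}"
    have "card (X i - T) = card (X i) - ?s i"
      using card_Diff_subset_Int[of "X i" T] fin[OF i] by (simp add: Int_commute)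
    moreover have "card {A. A \<subseteq> X i - T \<and> card A = r i - ?s i} = card (X i - T) choose (r i - ?s i)"
      by (rule n_subsets) (use fin[OF i] in simp)
    moreover have "nat (int (card (X i)) - int (?s i)) = card (X i) - ?s i"
      "nat (int (r i) - int (?s i)) = r i - ?s i" by simp_all
    ultimately show "card {A. A \<subseteq> X i - T \<and> card A = r i - ?s i} =
        binom (int (card (X i)) - int (?s i)) (int (r i) - int (?s i))"
      using sr[OF i] r[OF i] by (simp add: binom_def)
  qed
  finally show ?thesis .
qed (simp only: card.empty)

lemma card_star_le_star_bound:
  assumes fin: "\<And>i. i \<in> {1..p} \<Longrightarrow> finite (X i)" and disj: "disjoint_family_on X {1..p}"
    and n: "\<And>i. i \<in> {1..p} \<Longrightarrow> n i = card (X i)"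
    and R: "R \<subseteq> (\<Pi>\<^sub>E i\<in>{1..p}. {0..n i})"
    and T: "T \<subseteq> (\<Union>i\<in>{1..p}. X i)" "card T = t"
  shows "card {F \<in> layers p X R. T \<subseteq> F} \<le> star_bound t p n R"
proof -
  let ?s = "\<lambda>i\<in>{1..p}. card (T \<inter> X i)"
  let ?b = "\<lambda>s. \<Sum>r\<in>R. \<Prod>i\<in>{1..p}. binom (int (n i) - int (s i)) (int (r i) - int (s i))"
  have finR: "finite R" by (rule finite_subset[OF R]) (intro finite_PiE; simp)
  have "{F \<in> layers p X R. T \<subseteq> F} = (\<Union>r\<in>R. {F \<in> layer p X r. T \<subseteq> F})" by (auto simp: layers_def)
  then have "card {F \<in> layers p X R. T \<subseteq> F} \<le> (\<Sum>r\<in>R. card {F \<in> layer p X r. T \<subseteq> F})"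
    using card_UN_le[OF finR] by simp
  also have "\<dots> \<le> ?b ?s"
  proof (rule sum_mono)
    fix r assume "r \<in> R"
    then have "r i \<le> card (X i)" if "i \<in> {1..p}" for i using R n that by (fastforce simp: PiE_iff)
    then have "card {F \<in> layer p X r. T \<subseteq> F} \<le>
      (\<Prod>i\<in>{1..p}. binom (int (card (X i)) - int (card (T \<inter> X i))) (int (r i) - int (card (T \<inter> X i))))"
      using card_layer_star_le[OF fin T(1)] by blast
    also have "\<dots> = (\<Prod>i\<in>{1..p}. binom (int (n i) - int (?s i)) (int (r i) - int (?s i)))"
      by (rule prod.cong) (use n in auto)
    finally show "card {F \<in> layer p X r. T \<subseteq> F} \<le> (\<Prod>i\<in>{1..p}. binom (int (n i) - int (?s i)) (int (r i) - int (?s i)))" .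
  qed
  also have "\<dots> \<le> star_bound t p n R"
    unfolding star_bound_def
  proof (rule Max_ge)
    have "T = (\<Union>i\<in>{1..p}. T \<inter> X i)" using T by blast
    then have "t = card (\<Union>i\<in>{1..p}. T \<inter> X i)" using T(2) by metis
    also have "\<dots> = (\<Sum>i\<in>{1..p}. card (T \<inter> X i))"
    proof (rule card_UN_disjoint)
      show "\<forall>i\<in>{1..p}. \<forall>j\<in>{1..p}. i \<noteq> j \<longrightarrow> T \<inter> X i \<inter> (T \<inter> X j) = {}"
        using disj unfolding disjoint_family_on_def by blast
    qed (use fin in auto)
    finally have "?s \<in> weak_compositions p t" by (simp add: weak_compositions_def)
    then show "?b ?s \<in> ?b ` weak_compositions p t" by (rule imageI)
  qed (intro finite_imageI finite_weak_compositions)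
  finally show ?thesis .
qed

theorem theorem1p1:
  fixes p t :: nat
    and X :: "nat \<Rightarrow> 'a set"
    and n b :: "nat \<Rightarrow> nat"
    and R :: "(nat \<Rightarrow> nat) set"
    and \<F> :: "'a set set"
  assumes "p \<ge> 1" and "t \<ge> 1"
    and "finite (\<Union>i\<in>{1..p}. X i)"
    and "disjoint_family_on X {1..p}"
    and "\<And>i. i \<in> {1..p} \<Longrightarrow> X i \<noteq> {}"
    and "\<And>i. i \<in> {1..p} \<Longrightarrow> n i = card (X i)"
    and "R \<subseteq> (\<Pi>\<^sub>E i\<in>{1..p}. {0..n i})" and "R \<noteq> {}"
    and "\<And>i. i \<in> {1..p} \<Longrightarrow> b i = Max ((\<lambda>r. r i) ` R)"
    and "\<And>i. i \<in> {1..p} \<Longrightarrow> b i > 0"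
    and "Max ((\<lambda>r. \<Sum>i\<in>{1..p}. r i) ` R) \<ge> t"
    and "\<And>i. i \<in> {1..p} \<Longrightarrow> n i \<ge> 3 * p * t * b i"
    and "\<F> \<subseteq> layers p X R"
    and "t_intersecting t \<F>"
  shows "card \<F> \<le> star_bound t p n R \<and>
    (card \<F> = star_bound t p n R \<longleftrightarrow>
       full_star t p X R \<F> \<and> card \<F> = star_bound t p n R)"
proof -
  have fin: "finite (X i)" if "i \<in> {1..p}" for i
    by (rule finite_subset[OF _ assms(3)]) (use that in blast)
  have finR: "finite R" by (rule finite_subset[OF assms(7)]) (intro finite_PiE; simp)
  have r_le: "r i \<le> card (X i)" if "r \<in> R" "i \<in> {1..p}" for r i
    using assms(6,7) that by (fastforce simp: PiE_iff)
  have "Max ((\<lambda>r. \<Sum>i\<in>{1..p}. r i) ` R) \<in> (\<lambda>r. \<Sum>i\<in>{1..p}. r i) ` R"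
    by (rule Max_in) (use finR assms(8) in auto)
  then obtain r where r: "r \<in> R" "t \<le> (\<Sum>i\<in>{1..p}. r i)" using assms(11) by auto
  interpret partite_family p t X b "layers p X R"
  proof
    show "1 \<le> p" "1 \<le> t" "disjoint_family_on X {1..p}" by fact+
    show "finite (X i)" if "i \<in> {1..p}" for i using fin that .
    show "0 < b i" if "i \<in> {1..p}" for i using assms(10) that .
    show "3 * p * t * b i \<le> card (X i)" if "i \<in> {1..p}" for i using assms(6,12)[OF that] by simp
    show "F \<subseteq> (\<Union>i\<in>{1..p}. X i)" if "F \<in> layers p X R" for F
      using that by (auto simp: layers_def layer_def)
    show "card (F \<inter> X i) \<le> b i" if F: "F \<in> layers p X R" and i: "i \<in> {1..p}" for F i
    proof -
      obtain q where "q \<in> R" "card (F \<inter> X i) = q i" using F i by (auto simp: layers_def layer_def)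
      then show ?thesis using assms(9)[OF i] Max_ge[of "(\<lambda>r. r i) ` R" "q i"] finR by simp
    qed
    show "insert z (F - {y}) \<in> layers p X R"
      if "F \<in> layers p X R" "i \<in> {1..p}" "y \<in> F \<inter> X i" "z \<in> X i - F" for F i y z
      using layers_exchange[OF fin assms(4) that] .
    show "\<exists>F\<in>layers p X R. t \<le> card F"
      using layers_large_member[OF fin assms(4) r(1) r_le[OF r(1)]] r(2) by metis
  qed
  obtain \<G> where G: "max_family \<G>" using max_family_exists by blast
  then obtain T where T: "T \<subseteq> U" "card T = t" "\<G> = star T" using max_family_is_star by blast
  have le: "card \<F> \<le> card \<G>" using G assms(13,14) by (simp add: max_family_def)
  have bound: "card \<G> \<le> star_bound t p n R"
    unfolding T(3) star_def by (rule card_star_le_star_bound[OF fin assms(4,6,7) T(1,2)])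
  have "full_star t p X R \<F>" if "card \<F> = star_bound t p n R"
  proof -
    have "card \<G> \<le> card \<F>" using bound that by simp
    then have "max_family \<F>"
      using G assms(13,14) unfolding max_family_def by (meson order_trans)
    from max_family_is_star[OF this] show ?thesis by (simp only: full_star_def star_def)
  qed
  then show ?thesis using le bound by auto
qed

end
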